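(* Assume $X$ has finite variation, i.e. $\sigma=0$ and $\int_{|x|\le1}|x|\nu(dx)<\infty$, and that $d_+>0$. Then $$\lim_{t\to T}\frac{1}{T-t}\Big(\frac{K}{b(t)}-1\Big)=\int(e^y-1)_-\,\nu(dy).$$
   Context: Let $X$ be a real Lévy process with characteristic triplet $(\sigma^2,\gamma,\nu)$; $(\mathcal F_t)$ the usual augmentation of its natural filtration. Fix $T>0$, $K>0$, $r>0$, $\delta\ge0$. Assume $\int_{|x|\ge1}e^x\nu(dx)<\infty$ and $\frac{\sigma^2}{2}+\gamma+\int(e^x-1-x\mathbf 1_{|x|\le1})\nu(dx)=0$, and the non-degeneracy condition: $\sigma\neq0$, or $\nu((-\infty,0))>0$, or $\int_{(0,\infty)}(x\wedge1)\nu(dx)=\infty$. For $x\ge0$ let $S^x_t=xe^{(r-\delta)t+X_t}$; $P(t,x)=\sup_{\tau\in\mathcal T_{0,T-t}}\mathbb E[e^{-r\tau}(K-S^x_\tau)_+]$ (American put, $\mathcal T_{0,s}$ = stopping times in $[0,s]$), and $b(t)=\inf\{x\ge0:P(t,x)>(K-x)_+\}$, $t\in[0,T)$, its critical price. Let $d_+=r-\delta-\int(e^y-1)_+\nu(dy)$, and $(u)_-=\max(-u,0)$. *)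

theory Defs
  imports "HOL-Probability.Probability"
begin

definition levy_measure :: "real measure \<Rightarrow> bool" where
  "levy_measure \<nu> \<longleftrightarrow> sets \<nu> = sets borel \<and> emeasure \<nu> {0} = 0 \<and>
     (\<integral>\<^sup>+ x. ennreal (min 1 (x\<^sup>2)) \<partial>\<nu>) < \<infinity>"

definition levy_exponent :: "real \<Rightarrow> real \<Rightarrow> real measure \<Rightarrow> real \<Rightarrow> complex" where
  "levy_exponent \<sigma> \<gamma> \<nu> u =
     \<i> * complex_of_real (\<gamma> * u) - complex_of_real (\<sigma>\<^sup>2 * u\<^sup>2 / 2)
     + (\<integral> x. (iexp (u * x) - 1 - \<i> * complex_of_real (u * x * indicator {-1..1} x)) \<partial>\<nu>)"

definition levy_process ::
  "'a measure \<Rightarrow> (real \<Rightarrow> 'a \<Rightarrow> real) \<Rightarrow> real \<Rightarrow> real \<Rightarrow> real measure \<Rightarrow> bool" where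
  "levy_process M X \<sigma> \<gamma> \<nu> \<longleftrightarrow>
     prob_space M \<and> levy_measure \<nu> \<and>
     (\<forall>t. X t \<in> borel_measurable M) \<and>
     (\<forall>\<omega>\<in>space M. X 0 \<omega> = 0) \<and>
     (\<forall>\<omega>\<in>space M. \<forall>t\<ge>0. continuous (at_right t) (\<lambda>s. X s \<omega>)) \<and>
     (\<forall>\<omega>\<in>space M. \<forall>t>0. \<exists>l. ((\<lambda>s. X s \<omega>) \<longlongrightarrow> l) (at_left t)) \<and>
     (\<forall>(ts::nat \<Rightarrow> real) n. 0 \<le> ts 0 \<and> (\<forall>i<n. ts i \<le> ts (Suc i)) \<longrightarrow>
        prob_space.indep_vars M (\<lambda>_. borel) (\<lambda>i \<omega>. X (ts (Suc i)) \<omega> - X (ts i) \<omega>) {..<n}) \<and>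
     (\<forall>s t. 0 \<le> s \<and> s \<le> t \<longrightarrow>
        distr M borel (\<lambda>\<omega>. X t \<omega> - X s \<omega>) = distr M borel (X (t - s))) \<and>
     (\<forall>t\<ge>0. \<forall>u. char (distr M borel (X t)) u = exp (complex_of_real t * levy_exponent \<sigma> \<gamma> \<nu> u))"

definition levy_filtration :: "'a measure \<Rightarrow> (real \<Rightarrow> 'a \<Rightarrow> real) \<Rightarrow> real \<Rightarrow> 'a measure" where
  "levy_filtration M X t = sigma (space M)
     (\<Inter>s\<in>{t<..}. sigma_sets (space M)
        ({X u -` B \<inter> space M | u B. 0 \<le> u \<and> u \<le> s \<and> B \<in> sets borel}
         \<union> null_sets (completion M)))"

definition stopping_times_upto ::
  "'a measure \<Rightarrow> (real \<Rightarrow> 'a \<Rightarrow> real) \<Rightarrow> real \<Rightarrow> ('a \<Rightarrow> real) set" where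
  "stopping_times_upto M X s =
     {\<tau>. stopping_time (levy_filtration M X) \<tau> \<and> (\<forall>\<omega>\<in>space M. 0 \<le> \<tau> \<omega> \<and> \<tau> \<omega> \<le> s)}"

definition put_price ::
  "'a measure \<Rightarrow> (real \<Rightarrow> 'a \<Rightarrow> real) \<Rightarrow> real \<Rightarrow> real \<Rightarrow> real \<Rightarrow> real \<Rightarrow> real \<Rightarrow> real \<Rightarrow> real" where
  "put_price M X r \<delta> K T t x =
     Sup ((\<lambda>\<tau>. \<integral>\<omega>. exp (- r * \<tau> \<omega>) *
                max 0 (K - x * exp ((r - \<delta>) * \<tau> \<omega> + X (\<tau> \<omega>) \<omega>)) \<partial>completion M)
          ` stopping_times_upto M X (T - t))"

definition critical_price ::
  "'a measure \<Rightarrow> (real \<Rightarrow> 'a \<Rightarrow> real) \<Rightarrow> real \<Rightarrow> real \<Rightarrow> real \<Rightarrow> real \<Rightarrow> real \<Rightarrow> real" where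
  "critical_price M X r \<delta> K T t = Inf {x. 0 \<le> x \<and> put_price M X r \<delta> K T t x > max 0 (K - x)}"

end

theory Submission
  imports Defs
begin

text \<open>
  Write \<open>N = \<integral>(e\<^sup>y - 1)\<^sub>- \<nu>(dy)\<close> and let \<open>d\<close> be \<open>r - \<delta>\<close> plus the drift of \<open>X\<close>, so that \<open>d = d\<^sub>+ + N > N\<close>.
  Everything rests on the one-period estimate \<open>E(1 + a t - e\<^bsup>(r-\<delta>)t + X t\<^esup>)\<^sub>+ = N t + o(t)\<close> for
  \<open>a \<le> d\<close>. The law of \<open>X t\<close> minus its drift is a weak limit of \<open>m\<close>-fold convolutions of
  \<open>(1 - p) \<delta>\<^sub>0 + (t/m) \<nu>|{|y| > 1/n}\<close>, and expectations of sub- or almost superadditive functions under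
  such convolutions are controlled by their \<open>\<nu>\<close>-integrals: \<open>y \<mapsto> (1 - e\<^sup>y)\<^sub>+\<close> is subadditive, and
  \<open>y \<mapsto> (1 - \<eta> - e\<^sup>y)\<^sub>+\<close> is superadditive up to \<open>(2/\<eta>) min(1,|x|) min(1,|y|)\<close>.

  For \<open>l < N\<close> and \<open>s = T - t\<close> small, the European put at \<open>x = K / (1 + l s)\<close> is already worth more than
  \<open>K - x\<close>, so the critical price is at most \<open>K / (1 + l s)\<close>. For \<open>N < l < d\<close> the function
  \<open>max (K - S) (K l \<theta>)\<close> of the price \<open>S\<close> and the time to maturity \<open>\<theta>\<close> dominates the payoff and is a
  supermartingale along the price, even without discounting; it equals \<open>K - S\<close> for
  \<open>S \<le> K (1 - l \<theta>)\<close>, so the critical price is at least \<open>K (1 - l s)\<close>.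
\<close>

section \<open>Convolution powers\<close>

lemma real_distribution_add_distr:
  assumes "real_distribution \<mu>" "real_distribution \<rho>"
  shows "real_distribution (distr (\<mu> \<Otimes>\<^sub>M \<rho>) borel (\<lambda>(x, y). x + y))"
proof -
  interpret m: real_distribution \<mu> by fact
  interpret r: real_distribution \<rho> by fact
  interpret p: pair_prob_space \<mu> \<rho> ..
  show ?thesis
    by (intro real_distribution.intro p.prob_space_distr real_distribution_axioms.intro) auto
qed

lemma integral_add_distr:
  fixes f :: "real \<Rightarrow> 'b::{banach, second_countable_topology}"
  assumes "real_distribution \<mu>" "real_distribution \<rho>"
    and f[measurable]: "f \<in> borel_measurable borel" and bd: "\<And>x. norm (f x) \<le> B"
  shows "(\<integral>z. f z \<partial>distr (\<mu> \<Otimes>\<^sub>M \<rho>) borel (\<lambda>(x, y). x + y)) = (\<integral>x. \<integral>y. f (x + y) \<partial>\<rho> \<partial>\<mu>)"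
proof -
  interpret m: real_distribution \<mu> by fact
  interpret r: real_distribution \<rho> by fact
  interpret p: pair_prob_space \<mu> \<rho> ..
  have "(\<integral>z. f z \<partial>distr (\<mu> \<Otimes>\<^sub>M \<rho>) borel (\<lambda>(x, y). x + y)) = (\<integral>z. f (fst z + snd z) \<partial>(\<mu> \<Otimes>\<^sub>M \<rho>))"
    by (subst integral_distr) (auto simp: case_prod_beta)
  also have "\<dots> = (\<integral>x. \<integral>y. f (x + y) \<partial>\<rho> \<partial>\<mu>)"
    by (subst p.integral_fst'[symmetric])
       (auto intro!: p.integrable_const_bound[where B=B] bd)
  finally show ?thesis .
qed

text \<open>The law of a sum of \<open>k\<close> independent variables with law
  \<open>\<rho>\<close>. The recursion splits off the last summand, which Fubini turns into an
  iterated integral.\<close>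

primrec conv_pow :: "real measure \<Rightarrow> nat \<Rightarrow> real measure" where
  "conv_pow \<rho> 0 = return borel 0"
| "conv_pow \<rho> (Suc k) = distr (conv_pow \<rho> k \<Otimes>\<^sub>M \<rho>) borel (\<lambda>(x, y). x + y)"

lemma real_distribution_conv_pow:
  assumes "real_distribution \<rho>" shows "real_distribution (conv_pow \<rho> k)"
proof (induction k)
  case 0
  then show ?case
    by (simp add: real_distribution_def real_distribution_axioms_def prob_space_return)
next
  case (Suc k)
  then show ?case using real_distribution_add_distr[OF _ assms] by simp
qed

lemma integral_conv_pow_Suc:
  fixes f :: "real \<Rightarrow> 'b::{banach, second_countable_topology}"
  assumes "real_distribution \<rho>" "f \<in> borel_measurable borel" "\<And>x. norm (f x) \<le> B"
  shows "(\<integral>z. f z \<partial>conv_pow \<rho> (Suc k)) = (\<integral>x. \<integral>y. f (x + y) \<partial>\<rho> \<partial>conv_pow \<rho> k)"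
  using integral_add_distr[OF real_distribution_conv_pow[OF assms(1)] assms] by simp

lemma (in real_distribution) integrable_bounded:
  fixes f :: "real \<Rightarrow> 'b::{banach, second_countable_topology}"
  assumes "f \<in> borel_measurable borel" "\<And>x. norm (f x) \<le> B"
  shows "integrable M f"
  using assms by (intro integrable_const_bound[where B=B]) auto

lemma char_conv_pow:
  assumes "real_distribution \<rho>" shows "char (conv_pow \<rho> k) u = char \<rho> u ^ k"
proof (induction k)
  case 0
  then show ?case by (simp add: char_def integral_return)
next
  case (Suc k)
  have "char (conv_pow \<rho> (Suc k)) u = (\<integral>x. \<integral>y. iexp (u * (x + y)) \<partial>\<rho> \<partial>conv_pow \<rho> k)"
    unfolding char_def by (rule integral_conv_pow_Suc[OF assms, where B=1]) auto
  also have "\<dots> = (\<integral>x. \<integral>y. iexp (u * x) * iexp (u * y) \<partial>\<rho> \<partial>conv_pow \<rho> k)"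
    by (intro Bochner_Integration.integral_cong refl) (simp add: algebra_simps exp_add)
  also have "\<dots> = char (conv_pow \<rho> k) u * char \<rho> u"
    by (simp add: char_def)
  finally show ?case using Suc by simp
qed

lemma (in real_distribution) norm_integral_bounded:
  fixes f :: "real \<Rightarrow> 'b::{banach, second_countable_topology}"
  assumes "f \<in> borel_measurable borel" "\<And>x. norm (f x) \<le> B"
  shows "norm (\<integral>x. f x \<partial>M) \<le> B"
proof -
  have "norm (\<integral>x. f x \<partial>M) \<le> (\<integral>x. norm (f x) \<partial>M)"
    by (rule integral_norm_bound)
  also have "\<dots> \<le> (\<integral>x. B \<partial>M)"
    using integrable_bounded[OF assms] assms(2) by (intro integral_mono) auto
  finally show ?thesis by (simp add: prob_space[unfolded space_eq_univ])
qed

text \<open>Integrate \<open>super\<close> over independent \<open>x\<close> and \<open>y\<close>;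
  independence factors the mean of the error term \<open>C * w x * w y\<close>.\<close>

lemma integral_conv_pow_Suc_ge:
  fixes g w :: "real \<Rightarrow> real"
  assumes \<rho>: "real_distribution \<rho>"
    and g[measurable]: "g \<in> borel_measurable borel" and gbd: "\<And>x. \<bar>g x\<bar> \<le> B"
    and w[measurable]: "w \<in> borel_measurable borel" and wbd: "\<And>x. \<bar>w x\<bar> \<le> B"
    and super: "\<And>x y. g x + g y - C * w x * w y \<le> g (x + y)"
  shows "(\<integral>x. g x \<partial>conv_pow \<rho> k) + (\<integral>x. g x \<partial>\<rho>)
           - C * (\<integral>x. w x \<partial>conv_pow \<rho> k) * (\<integral>x. w x \<partial>\<rho>)
         \<le> (\<integral>x. g x \<partial>conv_pow \<rho> (Suc k))"
proof -
  interpret r: real_distribution \<rho> by fact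
  interpret c: real_distribution "conv_pow \<rho> k" by (rule real_distribution_conv_pow[OF \<rho>])
  have [simp]: "integrable \<rho> g" "integrable (conv_pow \<rho> k) g" "integrable \<rho> w" "integrable (conv_pow \<rho> k) w"
    using gbd wbd by (auto intro!: r.integrable_bounded[where B=B] c.integrable_bounded[where B=B])
  have [simp]: "integrable \<rho> (\<lambda>y. g (x + y))" for x
    using gbd by (intro r.integrable_bounded[where B=B]) auto
  have [simp]: "measure \<rho> UNIV = 1" "measure (conv_pow \<rho> k) UNIV = 1"
    using r.prob_space c.prob_space by auto
  have "(\<integral>x. g x \<partial>conv_pow \<rho> k) + (\<integral>x. g x \<partial>\<rho>)
           - C * (\<integral>x. w x \<partial>conv_pow \<rho> k) * (\<integral>x. w x \<partial>\<rho>)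
     = (\<integral>x. g x + (\<integral>y. g y \<partial>\<rho>) - (C * (\<integral>y. w y \<partial>\<rho>)) * w x \<partial>conv_pow \<rho> k)"
    by (subst Bochner_Integration.integral_diff) auto
  also have "\<dots> \<le> (\<integral>x. \<integral>y. g (x + y) \<partial>\<rho> \<partial>conv_pow \<rho> k)"
  proof (rule integral_mono)
    show "integrable (conv_pow \<rho> k) (\<lambda>x. \<integral>y. g (x + y) \<partial>\<rho>)"
    proof (rule c.integrable_bounded)
      show "norm (\<integral>y. g (x + y) \<partial>\<rho>) \<le> B" for x
        using gbd by (intro r.norm_integral_bounded) auto
    qed measurable
    fix x
    have "g x + (\<integral>y. g y \<partial>\<rho>) - (C * (\<integral>y. w y \<partial>\<rho>)) * w x = (\<integral>y. g x + g y - C * w x * w y \<partial>\<rho>)"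
      by (subst Bochner_Integration.integral_diff) auto
    also have "\<dots> \<le> (\<integral>y. g (x + y) \<partial>\<rho>)"
      by (intro integral_mono) (auto intro: super)
    finally show "g x + (\<integral>y. g y \<partial>\<rho>) - (C * (\<integral>y. w y \<partial>\<rho>)) * w x \<le> (\<integral>y. g (x + y) \<partial>\<rho>)" .
  qed auto
  also have "\<dots> = (\<integral>x. g x \<partial>conv_pow \<rho> (Suc k))"
    using integral_conv_pow_Suc[OF \<rho> g, of B] gbd by auto
  finally show ?thesis .
qed

text \<open>Adding one more summand to \<open>j\<close> of them costs at most
  \<open>C * (j * W) * W\<close>, where \<open>W\<close> is the mean of \<open>w\<close> under
  \<open>\<rho>\<close>, because subadditivity bounds the mean of \<open>w\<close> under
  \<open>conv_pow \<rho> j\<close> by \<open>j * W\<close>. Summed over \<open>j < k\<close> this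
  stays below \<open>C * (k * W)^2\<close>, an error of second order when \<open>k * W\<close> is
  small.\<close>

lemma integral_conv_pow_ge:
  fixes g w :: "real \<Rightarrow> real"
  assumes \<rho>: "real_distribution \<rho>"
    and g[measurable]: "g \<in> borel_measurable borel" and gbd: "\<And>x. \<bar>g x\<bar> \<le> B" and g0: "g 0 = 0"
    and w[measurable]: "w \<in> borel_measurable borel" and wbd: "\<And>x. \<bar>w x\<bar> \<le> B" and w0: "w 0 = 0"
    and wpos: "\<And>x. 0 \<le> w x" and C: "0 \<le> C"
    and sub: "\<And>x y. w (x + y) \<le> w x + w y"
    and super: "\<And>x y. g x + g y - C * w x * w y \<le> g (x + y)"
  shows "real k * (\<integral>x. g x \<partial>\<rho>) - C * (real k * (\<integral>x. w x \<partial>\<rho>))\<^sup>2 \<le> (\<integral>x. g x \<partial>conv_pow \<rho> k)"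
proof (induction k)
  case 0
  then show ?case using g0 by (simp add: integral_return)
next
  case (Suc k)
  define W where "W = (\<integral>x. w x \<partial>\<rho>)"
  have W0: "0 \<le> W" unfolding W_def by (rule integral_nonneg_AE) (simp add: wpos)
  have Wk: "(\<integral>x. w x \<partial>conv_pow \<rho> j) \<le> real j * W" for j
  proof (induction j)
    case 0
    then show ?case by (simp add: integral_return w0)
  next
    case (Suc j)
    \<comment> \<open>Subadditivity of \<open>w\<close> is superadditivity of \<open>- w\<close>
      with error weight zero.\<close>
    have "(\<integral>x. - w x \<partial>conv_pow \<rho> j) + (\<integral>x. - w x \<partial>\<rho>) \<le> (\<integral>x. - w x \<partial>conv_pow \<rho> (Suc j))"
      using integral_conv_pow_Suc_ge[OF \<rho>, of "\<lambda>x. - w x" B "\<lambda>x. 0" 0 j] wbd sub order_trans[OF abs_ge_zero wbd]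
      by (auto simp: algebra_simps)
    then show ?case using Suc W_def by (simp add: algebra_simps)
  qed
  have "real (Suc k) * (\<integral>x. g x \<partial>\<rho>) - C * (real (Suc k) * W)\<^sup>2
     \<le> (real k * (\<integral>x. g x \<partial>\<rho>) - C * (real k * W)\<^sup>2) + (\<integral>x. g x \<partial>\<rho>) - C * (real k * W) * W"
  proof -
    have "C * (real k * W)\<^sup>2 + C * (real k * W) * W \<le> C * (real (Suc k) * W)\<^sup>2"
      using mult_nonneg_nonneg[OF mult_nonneg_nonneg[OF C], of "W * W" "1 + real k"] W0
      by (simp add: power2_eq_square algebra_simps)
    then show ?thesis by (simp add: algebra_simps)
  qed
  also have "\<dots> \<le> (\<integral>x. g x \<partial>conv_pow \<rho> k) + (\<integral>x. g x \<partial>\<rho>) - C * (\<integral>x. w x \<partial>conv_pow \<rho> k) * W"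
    using Suc[folded W_def] mult_right_mono[OF mult_left_mono[OF Wk[of k] C] W0] by simp
  also have "\<dots> \<le> (\<integral>x. g x \<partial>conv_pow \<rho> (Suc k))"
    unfolding W_def using gbd wbd super by (intro integral_conv_pow_Suc_ge[OF \<rho>, where B=B]) auto
  finally show ?case unfolding W_def .
qed

text \<open>The law \<open>(1 - p) \<delta>\<^sub>0 + \<kappa>\<close>, where \<open>p\<close> is the mass of \<open>\<kappa>\<close>.\<close>

definition atom_mix :: "real measure \<Rightarrow> real measure" where
  "atom_mix \<kappa> = distr (measure_pmf (bernoulli_pmf (measure \<kappa> UNIV)) \<Otimes>\<^sub>M
      (if measure \<kappa> UNIV = 0 then return borel 0 else density \<kappa> (\<lambda>_. ennreal (1 / measure \<kappa> UNIV))))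
      borel (\<lambda>(b, y). if b then y else 0)"

lemma
  fixes \<kappa> :: "real measure"
  assumes sets[measurable_cong]: "sets \<kappa> = sets borel" and mass: "emeasure \<kappa> UNIV \<le> 1"
  shows real_distribution_atom_mix: "real_distribution (atom_mix \<kappa>)"
    and integral_atom_mix: "\<And>(f :: real \<Rightarrow> 'b::{banach, second_countable_topology}) B.
       f \<in> borel_measurable borel \<Longrightarrow> (\<And>x. norm (f x) \<le> B) \<Longrightarrow>
       (\<integral>x. f x \<partial>atom_mix \<kappa>) = (1 - measure \<kappa> UNIV) *\<^sub>R f 0 + (\<integral>x. f x \<partial>\<kappa>)"
proof -
  define p where "p = measure \<kappa> UNIV"
  \<comment> \<open>The normalised \<open>\<kappa>\<close>. If \<open>\<kappa>\<close> has mass 0 a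
    point mass stands in for it; the Bernoulli variable then never selects it.\<close>
  define Q where "Q = (if p = 0 then return borel 0 else density \<kappa> (\<lambda>_. ennreal (1 / p)))"
  have sp: "space \<kappa> = UNIV" using sets_eq_imp_space_eq[OF sets] by simp
  have em: "emeasure \<kappa> UNIV = ennreal p"
    using mass unfolding p_def measure_def by (auto simp: top_unique ennreal_enn2real_if)
  interpret k: finite_measure \<kappa> by (rule finite_measureI) (simp add: sp em)
  have p: "0 \<le> p" "p \<le> 1" using mass unfolding em by (auto simp: p_def)
  have [measurable_cong]: "sets Q = sets borel" by (simp add: Q_def sets)
  have "prob_space Q"
  proof (cases "p = 0")
    case True
    then show ?thesis by (simp add: Q_def prob_space_return)
  next
    case False
    then have "emeasure Q (space Q) = 1"
      using p by (simp add: Q_def emeasure_density sp em nn_integral_cmult_indicator ennreal_mult[symmetric])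
    then show ?thesis by (rule prob_spaceI)
  qed
  interpret Q: prob_space Q by fact
  define b where "b = measure_pmf (bernoulli_pmf p)"
  interpret b: prob_space b unfolding b_def by (rule prob_space_measure_pmf)
  interpret bQ: pair_prob_space b Q ..
  have eq: "atom_mix \<kappa> = distr (b \<Otimes>\<^sub>M Q) borel (\<lambda>(b, y). if b then y else 0)"
    by (simp add: atom_mix_def b_def Q_def p_def)
  have [measurable_cong]: "sets b = sets (count_space UNIV)" by (simp add: b_def)
  show "real_distribution (atom_mix \<kappa>)"
    unfolding eq by (intro real_distribution.intro bQ.prob_space_distr real_distribution_axioms.intro) auto
  fix f :: "real \<Rightarrow> 'b" and B
  assume f[measurable]: "f \<in> borel_measurable borel" and bd: "\<And>x. norm (f x) \<le> B"
  have kf: "integrable \<kappa> f"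
    using bd by (intro k.integrable_const_bound[where B=B]) auto
  have Qf: "p *\<^sub>R (\<integral>y. f y \<partial>Q) = (\<integral>y. f y \<partial>\<kappa>)"
  proof (cases "p = 0")
    case True
    then have "AE x in \<kappa>. f x = 0"
      using em by (intro AE_I[where N=UNIV]) auto
    then have "(\<integral>y. f y \<partial>\<kappa>) = 0" by (rule integral_eq_zero_AE)
    with True show ?thesis by simp
  next
    case False
    then show ?thesis using p
      by (simp add: Q_def integral_density kf)
  qed
  have "(\<integral>x. f x \<partial>atom_mix \<kappa>) = (\<integral>z. f (if fst z then snd z else 0) \<partial>(b \<Otimes>\<^sub>M Q))"
    unfolding eq by (subst integral_distr) (auto simp: case_prod_beta)
  also have "\<dots> = (\<integral>c. \<integral>y. f (if c then y else 0) \<partial>Q \<partial>b)"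
    by (subst bQ.integral_fst'[symmetric])
       (auto intro!: bQ.integrable_const_bound[where B=B] bd cong: if_cong)
  also have "\<dots> = p *\<^sub>R (\<integral>y. f y \<partial>Q) + (1 - p) *\<^sub>R f 0"
    unfolding b_def using p by (subst integral_measure_pmf[where A=UNIV]) (auto simp: UNIV_bool Q.prob_space)
  finally show "(\<integral>x. f x \<partial>atom_mix \<kappa>) = (1 - measure \<kappa> UNIV) *\<^sub>R f 0 + (\<integral>x. f x \<partial>\<kappa>)"
    using Qf p_def by simp
qed

section \<open>Weak approximation of infinitely divisible laws\<close>

text \<open>With \<open>w = z / m\<close>, the numbers \<open>1 + w\<close> and \<open>exp w\<close>
  both lie in the closed unit disc, so their \<open>m\<close>-th powers differ by at most
  \<open>m\<close> times their distance. That distance is of order \<open>|w|^2\<close>, which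
  leaves an error of order \<open>|z|^2 / m\<close>. The bound \<open>le1\<close> is automatic when
  \<open>1 + w\<close> is a value of a characteristic function.\<close>

lemma tendsto_exp_of_power:
  fixes z :: "nat \<Rightarrow> complex" and m :: "nat \<Rightarrow> nat"
  assumes z: "z \<longlonglongrightarrow> l" and m: "filterlim m at_top sequentially" and m0: "\<And>n. 0 < m n"
    and le1: "\<And>n. norm (1 + z n / of_nat (m n)) \<le> 1"
  shows "(\<lambda>n. (1 + z n / of_nat (m n)) ^ m n) \<longlonglongrightarrow> exp l"
proof -
  define w where "w n = z n / of_nat (m n)" for n
  have im: "(\<lambda>n. inverse (real (m n))) \<longlonglongrightarrow> 0"
    by (intro tendsto_inverse_0_at_top filterlim_compose[OF filterlim_real_sequentially m])
  have bound: "norm ((1 + w n) ^ m n - exp (z n)) \<le> exp (norm (z n) * inverse (real (m n))) * (norm (z n))\<^sup>2 * inverse (real (m n))" for n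
  proof -
    \<comment> \<open>A point \<open>1 + w\<close> of the unit disc has \<open>Re w \<le> 0\<close>,
      which is what puts \<open>exp w\<close> into the disc as well.\<close>
    have "(norm (1 + w n))\<^sup>2 \<le> 1"
      using le1[of n] by (simp add: w_def power_le_one)
    then have "(1 + Re (w n))\<^sup>2 + (Im (w n))\<^sup>2 \<le> 1"
      by (simp add: cmod_power2)
    then have "2 * Re (w n) + (Re (w n))\<^sup>2 + (Im (w n))\<^sup>2 \<le> 0"
      by (simp add: power2_eq_square algebra_simps)
    then have "Re (w n) \<le> 0"
      using zero_le_power2[of "Re (w n)"] zero_le_power2[of "Im (w n)"] by linarith
    then have e1: "norm (exp (w n)) \<le> 1" by simp
    have "exp (z n) = exp (w n) ^ m n"
      using m0[of n] by (simp add: exp_of_nat_mult[symmetric] w_def)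
    then have "norm ((1 + w n) ^ m n - exp (z n)) \<le> real (m n) * norm ((1 + w n) - exp (w n))"
      using norm_power_diff[OF _ e1, of "1 + w n" "m n"] le1[of n] by (simp add: w_def)
    also have "\<dots> \<le> real (m n) * (exp (norm (w n)) * (norm (w n))\<^sup>2)"
      using Taylor_exp_field[of "w n" 1]
      by (intro mult_left_mono) (simp_all add: norm_minus_commute power2_eq_square)
    also have "real (m n) * (exp (norm (w n)) * (norm (w n))\<^sup>2)
        = exp (norm (z n) * inverse (real (m n))) * (norm (z n))\<^sup>2 * inverse (real (m n))"
    proof -
      have nw: "norm (w n) = norm (z n) * inverse (real (m n))"
        unfolding w_def norm_divide by (simp add: divide_inverse)
      have "a * (b * (c * d)\<^sup>2) = (b * c\<^sup>2 * d) * (a * d)" for a b c d :: real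
        by (simp add: power2_eq_square)
      from this[of "real (m n)" _ "norm (z n)" "inverse (real (m n))"] show ?thesis
        unfolding nw using m0[of n] by (simp only: right_inverse of_nat_eq_0_iff neq0_conv mult_1_right)
    qed
    finally show ?thesis .
  qed
  have "(\<lambda>n. exp (norm (z n) * inverse (real (m n))) * (norm (z n))\<^sup>2 * inverse (real (m n)))
      \<longlonglongrightarrow> exp (norm l * 0) * (norm l)\<^sup>2 * 0"
    by (intro tendsto_intros z im)
  then have "(\<lambda>n. (1 + w n) ^ m n - exp (z n)) \<longlonglongrightarrow> 0"
    by (intro Lim_null_comparison[OF always_eventually[OF allI[OF bound]]]) simp
  from tendsto_add[OF this tendsto_exp[OF z]] show ?thesis by (simp add: w_def)
qed

lemma min_1_abs_subadditive: "min 1 \<bar>x + y\<bar> \<le> min 1 \<bar>x\<bar> + min 1 \<bar>y :: real\<bar>"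
  by linarith

lemma norm_iexp_minus_1_le_abs: "norm (iexp (x::real) - 1) \<le> \<bar>x\<bar>"
  using iexp_approx1[of x 0] by simp

lemma norm_iexp_minus_1_le_2: "norm (iexp (x::real) - 1) \<le> 2"
  using iexp_approx2[of x 0] by simp

text \<open>Makes the integrand of the exponent dominated by \<open>min 1 \<bar>y\<bar>\<close>. The
  slope \<open>\<bar>u\<bar>\<close> serves for small \<open>y\<close>, the diameter 2 of the unit
  circle for large \<open>y\<close>.\<close>

lemma norm_iexp_minus_1_le: "norm (iexp (u * y) - 1) \<le> max 2 \<bar>u\<bar> * min 1 \<bar>y\<bar>"
proof (cases "\<bar>y\<bar> \<le> 1")
  case True
  have "norm (iexp (u * y) - 1) \<le> \<bar>u * y\<bar>"
    by (rule norm_iexp_minus_1_le_abs)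
  also have "\<dots> = \<bar>u\<bar> * min 1 \<bar>y\<bar>" using True by (simp add: abs_mult)
  also have "\<dots> \<le> max 2 \<bar>u\<bar> * min 1 \<bar>y\<bar>"
    by (rule mult_right_mono) auto
  finally show ?thesis .
next
  case False
  have "norm (iexp (u * y) - 1) \<le> 2" by (rule norm_iexp_minus_1_le_2)
  also have "\<dots> \<le> max 2 \<bar>u\<bar>" by (rule max.cobounded1)
  also have "\<dots> = max 2 \<bar>u\<bar> * min 1 \<bar>y\<bar>" using False by simp
  finally show ?thesis .
qed

text \<open>Approximate \<open>L\<close> by \<open>m\<close>-fold convolutions of laws that jump
  with a small probability, according to \<open>\<nu>\<close> without its small jumps. The
  inequality for convolution powers holds along the approximation and passes to the limit, by Levy's
  continuity theorem on the right and dominated convergence on the left. A subadditive function is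
  covered by applying this to its negative with \<open>C = 0\<close>.\<close>

theorem integral_infinitely_divisible_ge:
  fixes \<nu> L :: "real measure" and g :: "real \<Rightarrow> real"
  assumes sets[measurable_cong]: "sets \<nu> = sets borel"
    and W: "integrable \<nu> (\<lambda>y. min 1 \<bar>y\<bar>)"
    and L: "real_distribution L" and t: "0 < t"
    and char: "\<And>u. char L u = exp (complex_of_real t * (\<integral>y. iexp (u * y) - 1 \<partial>\<nu>))"
    and cont: "\<And>x. isCont g x" and gw: "\<And>x. \<bar>g x\<bar> \<le> B * min 1 \<bar>x\<bar>" and C: "0 \<le> C"
    and super: "\<And>x y. g x + g y - C * min 1 \<bar>x\<bar> * min 1 \<bar>y\<bar> \<le> g (x + y)"
  shows "t * (\<integral>y. g y \<partial>\<nu>) - C * (t * (\<integral>y. min 1 \<bar>y\<bar> \<partial>\<nu>))\<^sup>2 \<le> (\<integral>x. g x \<partial>L)"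
proof -
  interpret L: real_distribution L by fact
  define w :: "real \<Rightarrow> real" where "w y = min 1 \<bar>y\<bar>" for y
  have [measurable]: "g \<in> borel_measurable borel"
    using cont by (intro borel_measurable_continuous_onI continuous_at_imp_continuous_on) auto
  have [measurable]: "w \<in> borel_measurable borel" unfolding w_def by measurable
  have gB: "\<bar>g x\<bar> \<le> B" for x
  proof -
    have "0 \<le> B" using gw[of 1] by simp
    then have "B * min 1 \<bar>x\<bar> \<le> B" by (intro mult_left_le) auto
    then show ?thesis using gw[of x] by linarith
  qed
  define A :: "nat \<Rightarrow> real set" where "A n = {y. 1 / real (Suc n) < \<bar>y\<bar>}" for n
  have [measurable]: "A n \<in> sets borel" for n unfolding A_def by measurable
  \<comment> \<open>Dominated convergence: the sets \<open>A n\<close> exhaust everything except the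
    point 0, where such an \<open>f\<close> vanishes.\<close>
  have trunc: "(\<lambda>n. \<integral>y. indicator (A n) y *\<^sub>R f y \<partial>\<nu>) \<longlonglongrightarrow> (\<integral>y. f y \<partial>\<nu>)"
    if f[measurable]: "f \<in> borel_measurable borel" and fw: "\<And>y. norm (f y) \<le> D * w y"
    for f :: "real \<Rightarrow> 'c::{banach, second_countable_topology}" and D
  proof (rule integral_dominated_convergence[where w="\<lambda>y. D * w y"])
    show "integrable \<nu> (\<lambda>y. D * w y)" using W by (simp add: w_def)
    show "AE y in \<nu>. (\<lambda>n. indicator (A n) y *\<^sub>R f y) \<longlonglongrightarrow> f y"
    proof (rule AE_I2)
      fix y
      show "(\<lambda>n. indicator (A n) y *\<^sub>R f y) \<longlonglongrightarrow> f y"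
      proof (cases "y = 0")
        case True
        then have "f y = 0" using fw[of 0] by (simp add: w_def)
        then show ?thesis by simp
      next
        case False
        then have "eventually (\<lambda>n. 1 / real (Suc n) < \<bar>y\<bar>) sequentially"
          by (intro order_tendstoD[OF LIMSEQ_Suc[OF lim_1_over_n]]) auto
        then have "eventually (\<lambda>n. indicator (A n) y *\<^sub>R f y = f y) sequentially"
          by eventually_elim (simp add: A_def)
        then show ?thesis by (rule tendsto_eventually)
      qed
    qed
    show "AE y in \<nu>. norm (indicator (A n) y *\<^sub>R f y) \<le> D * w y" for n
    proof (rule AE_I2)
      fix y
      have "norm (indicator (A n) y *\<^sub>R f y) \<le> norm (f y)" by (simp add: indicator_def)
      with fw[of y] show "norm (indicator (A n) y *\<^sub>R f y) \<le> D * w y" by linarith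
    qed
  qed auto
  \<comment> \<open>Markov's inequality: \<open>w\<close> is at least \<open>1 / Suc n\<close> on
    \<open>A n\<close>.\<close>
  have Afin: "emeasure \<nu> (A n) < \<infinity>" for n
  proof -
    have "emeasure \<nu> (A n) \<le> (\<integral>\<^sup>+y. ennreal (real (Suc n) * w y) \<partial>\<nu>)"
    proof -
      have "emeasure \<nu> (A n) = (\<integral>\<^sup>+y. indicator (A n) y \<partial>\<nu>)" by simp
      also have "\<dots> \<le> (\<integral>\<^sup>+y. ennreal (real (Suc n) * w y) \<partial>\<nu>)"
      proof (rule nn_integral_mono)
        fix y
        have "1 \<le> real (Suc n) * w y" if "y \<in> A n"
          using that by (auto simp: A_def w_def min_def field_simps)
        then show "indicator (A n) y \<le> ennreal (real (Suc n) * w y)"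
          by (auto simp: indicator_def)
      qed
      finally show ?thesis .
    qed
    also have "\<dots> < \<infinity>"
      using W by (subst nn_integral_eq_integral) (auto simp: w_def)
    finally show ?thesis .
  qed
  define c where "c n = measure \<nu> (A n)" for n
  \<comment> \<open>The number of factors must tend to infinity, hence \<open>Suc n\<close>, and
    must exceed \<open>t * c n\<close>, so that the jump probability \<open>t * c n / m n\<close> is
    at most 1.\<close>
  define m where "m n = Suc n + nat \<lceil>t * c n\<rceil>" for n
  have m0: "0 < m n" for n by (simp add: m_def)
  have mc: "t * c n \<le> real (m n)" for n unfolding m_def by linarith
  have mlim: "filterlim m at_top sequentially"
    by (rule filterlim_at_top_mono[OF filterlim_ident]) (auto simp: m_def)
  define \<kappa> where "\<kappa> n = density \<nu> (\<lambda>y. ennreal (t / real (m n) * indicator (A n) y))" for n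
  have sets\<kappa>: "sets (\<kappa> n) = sets borel" for n by (simp add: \<kappa>_def sets)
  have emk: "emeasure (\<kappa> n) UNIV = ennreal (t / real (m n) * c n)" for n
  proof -
    have "emeasure (\<kappa> n) UNIV = (\<integral>\<^sup>+y. ennreal (t / real (m n)) * indicator (A n) y \<partial>\<nu>)"
      unfolding \<kappa>_def
      by (subst emeasure_density) (auto intro!: nn_integral_cong simp: indicator_def sets)
    also have "\<dots> = ennreal (t / real (m n)) * emeasure \<nu> (A n)"
      by (rule nn_integral_cmult_indicator) simp
    also have "emeasure \<nu> (A n) = ennreal (c n)"
      using Afin[of n] by (simp add: c_def emeasure_eq_ennreal_measure)
    finally show ?thesis using t by (simp add: ennreal_mult[symmetric] c_def)
  qed
  have mass: "emeasure (\<kappa> n) UNIV \<le> 1" for n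
    using mc[of n] m0[of n] by (simp add: emk field_simps)
  have int\<kappa>: "(\<integral>y. f y \<partial>\<kappa> n) = (t / real (m n)) *\<^sub>R (\<integral>y. indicator (A n) y *\<^sub>R f y \<partial>\<nu>)"
    if [measurable]: "f \<in> borel_measurable borel"
    for f :: "real \<Rightarrow> 'c::{banach, second_countable_topology}" and n
  proof -
    have "(\<integral>y. f y \<partial>\<kappa> n) = (\<integral>y. (t / real (m n) * indicator (A n) y) *\<^sub>R f y \<partial>\<nu>)"
      unfolding \<kappa>_def using t by (intro integral_density) auto
    also have "\<dots> = (\<integral>y. (t / real (m n)) *\<^sub>R (indicator (A n) y *\<^sub>R f y) \<partial>\<nu>)"
      by simp
    finally show ?thesis by (simp only: integral_scaleR_right)
  qed
  define \<rho> where "\<rho> n = atom_mix (\<kappa> n)" for n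
  have \<rho>: "real_distribution (\<rho> n)" for n
    unfolding \<rho>_def by (rule real_distribution_atom_mix[OF sets\<kappa> mass])
  \<comment> \<open>The atom at 0 contributes nothing when \<open>f 0 = 0\<close>, so the factor
    \<open>1 / m n\<close> is all that separates this integral from the truncated integral against
    \<open>t * \<nu>\<close>.\<close>
  have int\<rho>: "(\<integral>y. f y \<partial>\<rho> n) = (t / real (m n)) *\<^sub>R (\<integral>y. indicator (A n) y *\<^sub>R f y \<partial>\<nu>)"
    if [measurable]: "f \<in> borel_measurable borel" and "f 0 = 0" "\<And>x. norm (f x) \<le> D"
    for f :: "real \<Rightarrow> 'c::{banach, second_countable_topology}" and n D
    unfolding \<rho>_def using integral_atom_mix[OF sets\<kappa> mass, of f D n] int\<kappa>[of f n] that by simp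
  \<comment> \<open>This is the shape \<open>1 + z / m\<close> of
    \<open>tendsto_exp_of_power\<close>; its unit disc condition is the bound of a characteristic
    function by 1.\<close>
  have char\<rho>: "char (\<rho> n) u = 1 + (complex_of_real t * (\<integral>y. indicator (A n) y *\<^sub>R (iexp (u * y) - 1) \<partial>\<nu>)) / of_nat (m n)"
    for n u
  proof -
    interpret r: real_distribution "\<rho> n" by (rule \<rho>)
    have "char (\<rho> n) u = 1 + (\<integral>y. iexp (u * y) - 1 \<partial>\<rho> n)"
      using r.prob_space unfolding char_def
      by (subst Bochner_Integration.integral_diff) (auto intro!: r.integrable_bounded[where B=1])
    also have "(\<integral>y. iexp (u * y) - 1 \<partial>\<rho> n)
       = (t / real (m n)) *\<^sub>R (\<integral>y. indicator (A n) y *\<^sub>R (iexp (u * y) - 1) \<partial>\<nu>)"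
    proof (rule int\<rho>[of _ 2])
      show "norm (iexp (u * y) - 1) \<le> 2" for y
        by (rule norm_iexp_minus_1_le_2)
    qed auto
    finally show ?thesis by (simp add: scaleR_conv_of_real)
  qed
  have "(\<lambda>n. char (conv_pow (\<rho> n) (m n)) u) \<longlonglongrightarrow> char L u" for u
    unfolding char_conv_pow[OF \<rho>] char\<rho> char
  proof (rule tendsto_exp_of_power)
    show "(\<lambda>n. complex_of_real t * (\<integral>y. indicator (A n) y *\<^sub>R (iexp (u * y) - 1) \<partial>\<nu>))
       \<longlonglongrightarrow> complex_of_real t * (\<integral>y. iexp (u * y) - 1 \<partial>\<nu>)"
      by (intro tendsto_mult tendsto_const trunc[of _ "max 2 \<bar>u\<bar>"])
         (measurable, unfold w_def, rule norm_iexp_minus_1_le)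
    show "norm (1 + complex_of_real t * (\<integral>y. indicator (A n) y *\<^sub>R (iexp (u * y) - 1) \<partial>\<nu>) / of_nat (m n)) \<le> 1" for n
      using real_distribution.cmod_char_le_1[OF \<rho>[of n], of u] unfolding char\<rho> .
  qed (fact mlim m0)+
  then have "weak_conv_m (\<lambda>n. conv_pow (\<rho> n) (m n)) L"
    by (intro levy_continuity L real_distribution_conv_pow \<rho>)
  then have lim: "(\<lambda>n. \<integral>x. g x \<partial>conv_pow (\<rho> n) (m n)) \<longlonglongrightarrow> (\<integral>x. g x \<partial>L)"
  proof (rule weak_conv_imp_integral_bdd_continuous_conv[OF real_distribution_conv_pow[OF \<rho>] L _ cont])
    show "norm (g x) \<le> \<bar>B\<bar>" for x
      using gB[of x] by simp
  qed
  \<comment> \<open>A common bound for \<open>g\<close> and \<open>w\<close>, since \<open>w\<close>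
    reaches 1 and \<open>B\<close> may be smaller.\<close>
  have gbd: "\<bar>g x\<bar> \<le> max 1 \<bar>B\<bar>" for x
    using gB[of x] by linarith
  have g0: "g 0 = 0" using gw[of 0] by simp
  have low: "t * (\<integral>y. indicator (A n) y *\<^sub>R g y \<partial>\<nu>) - C * (t * (\<integral>y. indicator (A n) y *\<^sub>R w y \<partial>\<nu>))\<^sup>2
      \<le> (\<integral>x. g x \<partial>conv_pow (\<rho> n) (m n))" for n
  proof -
    have wbd: "\<bar>w x\<bar> \<le> max 1 \<bar>B\<bar>" for x unfolding w_def by simp
    have "real (m n) * (\<integral>x. g x \<partial>\<rho> n) - C * (real (m n) * (\<integral>x. w x \<partial>\<rho> n))\<^sup>2
        \<le> (\<integral>x. g x \<partial>conv_pow (\<rho> n) (m n))"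
    proof (rule integral_conv_pow_ge[OF \<rho>, where B="max 1 \<bar>B\<bar>"])
      show "\<bar>g x\<bar> \<le> max 1 \<bar>B\<bar>" for x by (rule gbd)
      show "\<bar>w x\<bar> \<le> max 1 \<bar>B\<bar>" for x by (rule wbd)
      show "g x + g y - C * w x * w y \<le> g (x + y)" for x y using super by (simp add: w_def)
      show "w (x + y) \<le> w x + w y" for x y using min_1_abs_subadditive by (simp add: w_def)
    qed (auto simp: w_def C g0)
    moreover have "real (m n) * (\<integral>x. g x \<partial>\<rho> n) = t * (\<integral>y. indicator (A n) y *\<^sub>R g y \<partial>\<nu>)"
    proof -
      have "(\<integral>x. g x \<partial>\<rho> n) = (t / real (m n)) *\<^sub>R (\<integral>y. indicator (A n) y *\<^sub>R g y \<partial>\<nu>)"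
        by (rule int\<rho>[of _ B]) (use gB g0 in auto)
      then show ?thesis using m0[of n] by simp
    qed
    moreover have "real (m n) * (\<integral>x. w x \<partial>\<rho> n) = t * (\<integral>y. indicator (A n) y *\<^sub>R w y \<partial>\<nu>)"
    proof -
      have "(\<integral>x. w x \<partial>\<rho> n) = (t / real (m n)) *\<^sub>R (\<integral>y. indicator (A n) y *\<^sub>R w y \<partial>\<nu>)"
        by (rule int\<rho>[of _ 1]) (auto simp: w_def)
      then show ?thesis using m0[of n] by simp
    qed
    ultimately show ?thesis by simp
  qed
  have "(\<lambda>n. t * (\<integral>y. indicator (A n) y *\<^sub>R g y \<partial>\<nu>) - C * (t * (\<integral>y. indicator (A n) y *\<^sub>R w y \<partial>\<nu>))\<^sup>2)
     \<longlonglongrightarrow> t * (\<integral>y. g y \<partial>\<nu>) - C * (t * (\<integral>y. w y \<partial>\<nu>))\<^sup>2"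
  proof (intro tendsto_diff tendsto_mult tendsto_const tendsto_power)
    show "(\<lambda>n. \<integral>y. indicator (A n) y *\<^sub>R g y \<partial>\<nu>) \<longlonglongrightarrow> (\<integral>y. g y \<partial>\<nu>)"
      by (rule trunc[of _ B]) (use gw in \<open>auto simp: w_def\<close>)
    show "(\<lambda>n. \<integral>y. indicator (A n) y *\<^sub>R w y \<partial>\<nu>) \<longlonglongrightarrow> (\<integral>y. w y \<partial>\<nu>)"
      by (rule trunc[of _ 1]) (auto simp: w_def)
  qed
  from LIMSEQ_le[OF this lim] low have
    "t * (\<integral>y. g y \<partial>\<nu>) - C * (t * (\<integral>y. w y \<partial>\<nu>))\<^sup>2 \<le> (\<integral>x. g x \<partial>L)"
    by blast
  then show ?thesis unfolding w_def .
qed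

section \<open>Small-time payoff estimates\<close>

text \<open>With \<open>a = exp x\<close> and \<open>b = exp y\<close>: if both are at most 1,
  expand \<open>0 \<le> (1 - a) * (1 - b)\<close>; if one of them exceeds 1, the product is at least
  the other one.\<close>

lemma max_one_minus_exp_subadditive:
  "max 0 (1 - exp (x + y)) \<le> max 0 (1 - exp x) + max 0 (1 - exp (y :: real))"
proof -
  have ineq: "1 - a * b \<le> max 0 (1 - a) + max 0 (1 - b)" if "0 \<le> a" "0 \<le> b" for a b :: real
  proof (cases "a \<le> 1 \<and> b \<le> 1")
    case True
    then have "0 \<le> (1 - a) * (1 - b)" by simp
    with True show ?thesis by (simp add: algebra_simps)
  next
    case False
    then show ?thesis
      using that mult_right_mono[of 1 a b] mult_left_mono[of 1 b a] mult_mono[of 1 a 1 b] by (auto simp: max_def)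
  qed
  show ?thesis using ineq[of "exp x" "exp y"] by (simp add: exp_add)
qed

lemma max_one_minus_exp_le: "max 0 (1 - exp x) \<le> min 1 \<bar>x :: real\<bar>"
proof -
  have "1 - exp x \<le> - x" using exp_ge_add_one_self[of x] by linarith
  then show ?thesis by (auto simp: min_def max_def)
qed

text \<open>Truncating at level \<open>\<eta>\<close> puts the kink of the payoff away from \<open>0\<close>; the kink being convex,
  it only helps superadditivity.\<close>

lemma max_truncated_payoff_superadditive:
  fixes x y \<eta> :: real
  assumes \<eta>: "0 < \<eta>" "\<eta> \<le> 1"
  defines "g \<equiv> \<lambda>y. max 0 (1 - \<eta> - exp y)"
  shows "g x + g y - 2 / \<eta> * min 1 \<bar>x\<bar> * min 1 \<bar>y\<bar> \<le> g (x + y)"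
proof -
  define w where "w x = min 1 \<bar>x\<bar>" for x :: real
  have w0: "0 \<le> w x" for x by (simp add: w_def)
  have zw: "1 - exp x \<le> w x" for x using max_one_minus_exp_le[of x] by (simp add: w_def)
  have ww: "w x * w y \<le> 2 / \<eta> * w x * w y" for x y
    using mult_right_mono[of 1 "2 / \<eta>" "w x * w y"] w0[of x] w0[of y] \<eta> by (simp add: field_simps)
  \<comment> \<open>Opposite signs, the origin of the constant \<open>2 / \<eta>\<close>. Here
    \<open>g b = 0\<close>, and there is something to lose only if \<open>g a > 0\<close>, which
    forces \<open>w a \<ge> \<eta>\<close>. The loss is at most \<open>2 * w b\<close>, and the
    factor \<open>w a / \<eta> \<ge> 1\<close> can be inserted.\<close>
  have mixed: "g a + g b - 2 / \<eta> * w a * w b \<le> g (a + b)" if ab: "a \<le> 0" "0 \<le> b" for a b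
  proof -
    have gb: "g b = 0" using ab \<eta> one_le_exp_iff[of b] by (simp add: g_def del: one_le_exp_iff)
    show ?thesis
    proof (cases "g a = 0")
      case True
      have "0 \<le> 2 / \<eta> * w a * w b" using w0 \<eta> by simp
      moreover have "0 \<le> g (a + b)" by (simp add: g_def)
      ultimately show ?thesis using True gb by simp
    next
      case False
      then have "\<eta> < 1 - exp a" by (auto simp: g_def max_def split: if_splits)
      then have wa: "\<eta> \<le> w a" using zw[of a] by simp
      have "g a - g (a + b) \<le> 2 * w b"
      proof (cases "b \<le> 1")
        case True
        have "g a - g (a + b) \<le> exp a * (exp b - 1)"
        proof -
          have "exp a \<le> exp (a + b)" using ab by simp
          then have "g a - g (a + b) \<le> exp (a + b) - exp a" unfolding g_def max_def by (smt (verit))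
          then show ?thesis by (simp add: exp_add algebra_simps)
        qed
        also have "\<dots> \<le> 1 * (exp b - 1)"
          using ab by (intro mult_right_mono) auto
        also have "\<dots> \<le> b + b\<^sup>2" using exp_bound[of b] ab True by simp
        also have "\<dots> \<le> 2 * b" using ab True mult_left_mono[of b 1 b] by (simp add: power2_eq_square)
        finally show ?thesis using True ab by (simp add: w_def)
      next
        case False
        have "g a - g (a + b) \<le> 1" using \<eta> by (auto simp: g_def max_def) (smt (verit) exp_gt_zero)+
        then show ?thesis using False by (simp add: w_def)
      qed
      also have "2 * w b \<le> (w a / \<eta>) * (2 * w b)"
        using mult_right_mono[of 1 "w a / \<eta>" "2 * w b"] wa w0[of b] \<eta> by simp
      finally show ?thesis using gb by (simp add: field_simps)
    qed
  qed
  consider "x \<le> 0" "y \<le> 0" | "0 \<le> x" "0 \<le> y" | "x \<le> 0" "0 \<le> y" | "y \<le> 0" "0 \<le> x" by linarith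
  then have "g x + g y - 2 / \<eta> * w x * w y \<le> g (x + y)"
  proof cases
    case 1
    have "(1 - exp x) * (1 - exp y) \<le> w x * w y"
      using 1 zw w0 by (intro mult_mono) auto
    then have *: "(1 - exp x) * (1 - exp y) \<le> 2 / \<eta> * w x * w y" using ww[of x y] by linarith
    have ge0: "0 \<le> (1 - exp x) * (1 - exp y)" using 1 by simp
    \<comment> \<open>If both values are positive, the left side equals
      \<open>1 - 2 * \<eta> - exp (x + y)\<close>.\<close>
    have "g x + g y - (1 - exp x) * (1 - exp y) \<le> g (x + y)"
    proof (cases "g x = 0 \<or> g y = 0")
      case True
      have "exp (x + y) \<le> exp x" "exp (x + y) \<le> exp y" using 1 by auto
      then have "g (x + y) \<ge> g x" "g (x + y) \<ge> g y"
        unfolding g_def by (intro max.mono; linarith)+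
      with True ge0 show ?thesis by auto
    next
      case False
      then have "g x = 1 - \<eta> - exp x" "g y = 1 - \<eta> - exp y" by (auto simp: g_def max_def split: if_splits)
      then have "g x + g y - (1 - exp x) * (1 - exp y) \<le> 1 - \<eta> - exp (x + y)"
        using \<eta> by (simp add: exp_add algebra_simps)
      then show ?thesis by (simp add: g_def)
    qed
    with * show ?thesis by linarith
  next
    case 2
    have "g x = 0" "g y = 0"
      using 2 \<eta> one_le_exp_iff[of x] one_le_exp_iff[of y] by (simp_all add: g_def del: one_le_exp_iff)
    moreover have "0 \<le> 2 / \<eta> * w x * w y" using w0 \<eta> by simp
    moreover have "0 \<le> g (x + y)" by (simp add: g_def)
    ultimately show ?thesis by simp
  next
    case 3
    then show ?thesis by (rule mixed)
  next
    case 4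
    then show ?thesis using mixed[of y x] by (simp add: algebra_simps)
  qed
  then show ?thesis by (simp add: w_def)
qed

section \<open>Levy processes: path and increment properties\<close>

locale levy_space =
  fixes M :: "'a measure" and X :: "real \<Rightarrow> 'a \<Rightarrow> real" and \<sigma> \<gamma> :: real and \<nu> :: "real measure"
  assumes levy: "levy_process M X \<sigma> \<gamma> \<nu>"

sublocale levy_space \<subseteq> prob_space M
  using levy by (simp add: levy_process_def)

context levy_space
begin

lemma sets_nu [measurable_cong]: "sets \<nu> = sets borel"
  using levy by (simp add: levy_process_def levy_measure_def)

lemma X_measurable [measurable]: "X t \<in> borel_measurable M"
  using levy by (simp add: levy_process_def)

lemma X_0: "\<omega> \<in> space M \<Longrightarrow> X 0 \<omega> = 0"
  using levy by (simp add: levy_process_def)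

lemma X_right_continuous: "\<omega> \<in> space M \<Longrightarrow> 0 \<le> t \<Longrightarrow> continuous (at_right t) (\<lambda>s. X s \<omega>)"
  using levy by (simp add: levy_process_def)

lemma X_increments_indep:
  "0 \<le> ts 0 \<Longrightarrow> (\<And>i. i < n \<Longrightarrow> ts i \<le> ts (Suc i)) \<Longrightarrow>
    indep_vars (\<lambda>_. borel) (\<lambda>i \<omega>. X (ts (Suc i)) \<omega> - X (ts i) \<omega>) {..<n}"
  using levy by (simp add: levy_process_def)

lemma X_increments_stationary:
  "0 \<le> s \<Longrightarrow> s \<le> t \<Longrightarrow> distr M borel (\<lambda>\<omega>. X t \<omega> - X s \<omega>) = distr M borel (X (t - s))"
  using levy by (simp add: levy_process_def)

end

section \<open>Finite variation: integrability against the Levy measure and the law of the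
  jumps\<close>

locale finite_variation_levy = levy_space M X 0 \<gamma> \<nu>
  for M :: "'a measure" and X \<gamma> \<nu> +
  assumes exp_moment: "(\<integral>\<^sup>+ x. indicator {x. \<bar>x\<bar> \<ge> 1} x * ennreal (exp x) \<partial>\<nu>) < \<infinity>"
    and martingale: "\<gamma> + (\<integral> x. exp x - 1 - x * indicator {-1..1} x \<partial>\<nu>) = 0"
    and fv: "(\<integral>\<^sup>+ x. indicator {-1..1} x * ennreal \<bar>x\<bar> \<partial>\<nu>) < \<infinity>"

context finite_variation_levy
begin

text \<open>Finite variation controls the jumps in \<open>[-1, 1]\<close>, the defining condition of
  a Levy measure those outside.\<close>

lemma integrable_min_1_abs: "integrable \<nu> (\<lambda>y. min 1 \<bar>y\<bar>)"
proof (rule integrableI_nonneg)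
  have "(\<integral>\<^sup>+y. ennreal (min 1 \<bar>y\<bar>) \<partial>\<nu>) \<le>
      (\<integral>\<^sup>+y. indicator {-1..1} y * ennreal \<bar>y\<bar> + ennreal (min 1 (y\<^sup>2)) \<partial>\<nu>)"
  proof (rule nn_integral_mono)
    fix y :: real
    show "ennreal (min 1 \<bar>y\<bar>) \<le> indicator {-1..1} y * ennreal \<bar>y\<bar> + ennreal (min 1 (y\<^sup>2))"
    proof (cases "\<bar>y\<bar> \<le> 1")
      case True
      then have "indicator {-1..1} y * ennreal \<bar>y\<bar> = ennreal \<bar>y\<bar>" by (auto simp: indicator_def)
      then show ?thesis using True by (simp add: add_increasing2)
    next
      case False
      then have "min 1 \<bar>y\<bar> = 1" "min 1 (y\<^sup>2) = 1" using abs_le_square_iff[of 1 y] by auto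
      then show ?thesis by (simp add: add_increasing)
    qed
  qed
  also have "\<dots> = (\<integral>\<^sup>+y. indicator {-1..1} y * ennreal \<bar>y\<bar> \<partial>\<nu>) + (\<integral>\<^sup>+y. ennreal (min 1 (y\<^sup>2)) \<partial>\<nu>)"
    by (rule nn_integral_add) auto
  also have "\<dots> < \<infinity>"
    using fv levy by (simp add: levy_process_def levy_measure_def)
  finally show "(\<integral>\<^sup>+y. ennreal (min 1 \<bar>y\<bar>) \<partial>\<nu>) < \<infinity>" .
qed auto

lemma integrable_le_min_1_abs:
  fixes f :: "real \<Rightarrow> 'b::{banach, second_countable_topology}"
  assumes "f \<in> borel_measurable borel" "\<And>y. norm (f y) \<le> D * min 1 \<bar>y\<bar>"
  shows "integrable \<nu> f"
proof (rule Bochner_Integration.integrable_bound)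
  show "integrable \<nu> (\<lambda>y. D * min 1 \<bar>y\<bar>)" using integrable_min_1_abs by simp
  show "AE y in \<nu>. norm (f y) \<le> norm (D * min 1 \<bar>y\<bar>)"
    using order_trans[OF assms(2) abs_ge_self] by (intro AE_I2) simp
qed (use assms in measurable)

lemma integrable_payoff: "integrable \<nu> (\<lambda>y. max 0 (1 - exp y))"
  by (rule integrable_le_min_1_abs[where D=1]) (use max_one_minus_exp_le in auto)

text \<open>Small jumps are dominated by a multiple of \<open>\<bar>x\<bar>\<close>, large ones
  through the exponential moment.\<close>

lemma integrable_exp_minus_1: "integrable \<nu> (\<lambda>y. exp y - 1)"
proof (rule Bochner_Integration.integrable_bound)
  have "integrable \<nu> (\<lambda>x. indicator {x. \<bar>x\<bar> \<ge> 1} x * exp x)"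
  proof (rule integrableI_nonneg)
    have "(\<integral>\<^sup>+x. ennreal (indicator {x. \<bar>x\<bar> \<ge> 1} x * exp x) \<partial>\<nu>)
       = (\<integral>\<^sup>+ x. indicator {x. \<bar>x\<bar> \<ge> 1} x * ennreal (exp x) \<partial>\<nu>)"
      by (intro nn_integral_cong) (auto simp: indicator_def)
    with exp_moment show "(\<integral>\<^sup>+x. ennreal (indicator {x. \<bar>x\<bar> \<ge> 1} x * exp x) \<partial>\<nu>) < \<infinity>" by simp
  qed auto
  then show "integrable \<nu> (\<lambda>x. 2 * min 1 \<bar>x\<bar> + indicator {x. \<bar>x\<bar> \<ge> 1} x * exp x)"
    using integrable_min_1_abs by simp
  show "AE x in \<nu>. norm (exp x - 1) \<le> norm (2 * min 1 \<bar>x\<bar> + indicator {x. \<bar>x\<bar> \<ge> 1} x * exp x)"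
  proof (rule AE_I2)
    fix x :: real
    have "\<bar>exp x - 1\<bar> \<le> 2 * min 1 \<bar>x\<bar> + indicator {x. \<bar>x\<bar> \<ge> 1} x * exp x"
    proof (cases "\<bar>x\<bar> \<ge> 1")
      case True
      have "\<bar>exp x - 1\<bar> \<le> 2 + exp x" using exp_gt_zero[of x] by linarith
      with True show ?thesis by simp
    next
      case False
      have "exp x - 1 \<le> 2 * \<bar>x\<bar>"
      proof (cases "0 \<le> x")
        case True
        have "exp x \<le> 1 + x + x\<^sup>2" using exp_bound[of x] False True by simp
        also have "x\<^sup>2 \<le> x" using False True mult_left_mono[of x 1 x] by (simp add: power2_eq_square)
        finally show ?thesis using True by simp
      next
        case 2: False
        then have "exp x \<le> 1" by simp
        then show ?thesis by (smt (verit))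
      qed
      moreover have "1 - exp x \<le> 2 * \<bar>x\<bar>" using exp_ge_add_one_self[of x] by (smt (verit))
      ultimately show ?thesis using False by (auto simp: abs_le_iff)
    qed
    then show "norm (exp x - 1) \<le> norm (2 * min 1 \<bar>x\<bar> + indicator {x. \<bar>x\<bar> \<ge> 1} x * exp x)" by simp
  qed
qed measurable

text \<open>The slope of the linear part of \<open>X\<close> once its jumps are no longer
  compensated, that is \<open>\<gamma>\<close> minus the integral of \<open>x\<close> over
  \<open>[-1, 1]\<close>; the martingale condition gives it this form.\<close>

definition drift :: real where "drift = - (\<integral>y. exp y - 1 \<partial>\<nu>)"

definition jump_law :: "real \<Rightarrow> real measure" where
  "jump_law t = distr M borel (\<lambda>\<omega>. X t \<omega> - drift * t)"

lemma real_distribution_jump_law: "real_distribution (jump_law t)"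
  unfolding jump_law_def by (intro real_distribution.intro prob_space_distr real_distribution_axioms.intro) auto

text \<open>Finite variation allows the compensator to be integrated separately, and the martingale
  condition turns the resulting coefficient of \<open>\<i> * u\<close> into
  \<open>drift\<close>.\<close>

lemma levy_exponent_eq:
  "levy_exponent 0 \<gamma> \<nu> u = \<i> * complex_of_real (drift * u) + (\<integral>y. iexp (u * y) - 1 \<partial>\<nu>)"
proof -
  have 1: "integrable \<nu> (\<lambda>x. x * indicator {-1..1} x)"
    by (rule integrable_le_min_1_abs[where D=1]) (auto simp: indicator_def)
  have 2: "integrable \<nu> (\<lambda>y. iexp (u * y) - 1)"
    by (rule integrable_le_min_1_abs[where D="max 2 \<bar>u\<bar>"]) (measurable, rule norm_iexp_minus_1_le)
  have A: "(\<integral> x. (iexp (u * x) - 1 - \<i> * complex_of_real (u * x * indicator {-1..1} x)) \<partial>\<nu>)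
    = (\<integral>y. iexp (u * y) - 1 \<partial>\<nu>) - \<i> * complex_of_real (u * (\<integral>x. x * indicator {-1..1} x \<partial>\<nu>))"
  proof -
    have "(\<integral> x. \<i> * complex_of_real (u * x * indicator {-1..1} x) \<partial>\<nu>)
        = (\<integral> x. (\<i> * complex_of_real u) * complex_of_real (x * indicator {-1..1} x) \<partial>\<nu>)"
      by (simp add: mult_ac)
    also have "\<dots> = (\<i> * complex_of_real u) * complex_of_real (\<integral>x. x * indicator {-1..1} x \<partial>\<nu>)"
      by (simp only: integral_mult_right_zero integral_complex_of_real)
    finally have e: "(\<integral> x. \<i> * complex_of_real (u * x * indicator {-1..1} x) \<partial>\<nu>)
       = \<i> * complex_of_real (u * (\<integral>x. x * indicator {-1..1} x \<partial>\<nu>))" by simp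
    have "integrable \<nu> (\<lambda>x. (\<i> * complex_of_real u) * complex_of_real (x * indicator {-1..1} x))"
      using 1 by (intro integrable_mult_right integrable_of_real)
    then have "integrable \<nu> (\<lambda>x. \<i> * complex_of_real (u * x * indicator {-1..1} x))"
      by (simp add: mult_ac)
    with e show ?thesis by (subst Bochner_Integration.integral_diff[OF 2]) auto
  qed
  have "(\<integral> x. exp x - 1 - x * indicator {-1..1} x \<partial>\<nu>)
     = (\<integral>x. exp x - 1 \<partial>\<nu>) - (\<integral>x. x * indicator {-1..1} x \<partial>\<nu>)"
    by (rule Bochner_Integration.integral_diff[OF integrable_exp_minus_1 1])
  then have B: "\<gamma> = drift + (\<integral>x. x * indicator {-1..1} x \<partial>\<nu>)"
    using martingale by (simp add: drift_def)
  show ?thesis unfolding levy_exponent_def A by (simp add: B algebra_simps)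
qed

lemma char_jump_law:
  assumes "0 \<le> t"
  shows "char (jump_law t) u = exp (complex_of_real t * (\<integral>y. iexp (u * y) - 1 \<partial>\<nu>))"
proof -
  have "char (jump_law t) u = (\<integral>\<omega>. iexp (u * (X t \<omega> - drift * t)) \<partial>M)"
    unfolding char_def jump_law_def by (subst integral_distr) auto
  also have "\<dots> = (\<integral>\<omega>. iexp (- (u * drift * t)) * iexp (u * X t \<omega>) \<partial>M)"
    by (intro Bochner_Integration.integral_cong refl) (simp add: exp_add[symmetric] algebra_simps)
  also have "\<dots> = iexp (- (u * drift * t)) * char (distr M borel (X t)) u"
    unfolding char_def by (subst integral_distr) auto
  also have "char (distr M borel (X t)) u = exp (complex_of_real t * levy_exponent 0 \<gamma> \<nu> u)"
    using levy assms by (simp add: levy_process_def)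
  finally show ?thesis
    by (simp add: levy_exponent_eq exp_add[symmetric] algebra_simps)
qed

section \<open>Upper and lower bounds for the expected payoff over a short period\<close>

lemmas jump_law_integral_ge =
  integral_infinitely_divisible_ge[OF sets_nu integrable_min_1_abs real_distribution_jump_law _ char_jump_law]

text \<open>From \<open>1 + d * t \<le> exp ((q + drift) * t)\<close> the growth of the strike is
  absorbed by the drift of the price and becomes a prefactor. The remaining payoff of the jumps is
  subadditive, so its mean is at most linear in \<open>t\<close>.\<close>

lemma integral_payoff_le:
  assumes t: "0 < t" and d: "0 \<le> d" "d \<le> q + drift"
  shows "(\<integral>\<omega>. max 0 (1 + d * t - exp (q * t + X t \<omega>)) \<partial>M) \<le> (1 + d * t) * (t * (\<integral>y. max 0 (1 - exp y) \<partial>\<nu>))"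
proof -
  \<comment> \<open>The negated payoff is superadditive, so \<open>C = 0\<close> leaves no error
    term.\<close>
  have "t * (\<integral>y. - max 0 (1 - exp y) \<partial>\<nu>) - 0 * (t * (\<integral>y. min 1 \<bar>y\<bar> \<partial>\<nu>))\<^sup>2
     \<le> (\<integral>x. - max 0 (1 - exp x) \<partial>jump_law t)"
    using t max_one_minus_exp_subadditive max_one_minus_exp_le
    by (intro jump_law_integral_ge[where B=1]) (auto intro!: continuous_intros simp: algebra_simps)
  then have J: "(\<integral>x. max 0 (1 - exp x) \<partial>jump_law t) \<le> t * (\<integral>y. max 0 (1 - exp y) \<partial>\<nu>)" by simp
  have "(\<integral>\<omega>. max 0 (1 + d * t - exp (q * t + X t \<omega>)) \<partial>M)
     \<le> (\<integral>\<omega>. (1 + d * t) * max 0 (1 - exp (X t \<omega> - drift * t)) \<partial>M)"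
  proof (rule integral_mono)
    show "integrable M (\<lambda>\<omega>. max 0 (1 + d * t - exp (q * t + X t \<omega>)))"
      using d t by (intro integrable_const_bound[where B="1 + d * t"]) auto
    show "integrable M (\<lambda>\<omega>. (1 + d * t) * max 0 (1 - exp (X t \<omega> - drift * t)))"
      using d t by (intro integrable_const_bound[where B="1 + d * t"]) (auto simp: abs_mult mult_left_le)
    fix \<omega>
    have "1 + d * t \<le> exp (d * t)" by simp
    also have "\<dots> \<le> exp ((q + drift) * t)" using d t by simp
    finally have "(1 + d * t) * exp (X t \<omega> - drift * t) \<le> exp ((q + drift) * t) * exp (X t \<omega> - drift * t)"
      by (rule mult_right_mono) simp
    also have "\<dots> = exp (q * t + X t \<omega>)" by (simp add: exp_add[symmetric] algebra_simps)
    finally have le: "1 + d * t - exp (q * t + X t \<omega>) \<le> (1 + d * t) * (1 - exp (X t \<omega> - drift * t))"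
      by (simp add: algebra_simps)
    have "0 \<le> 1 + d * t" using d t by simp
    then have "(1 + d * t) * max 0 (1 - exp (X t \<omega> - drift * t))
       = max 0 ((1 + d * t) * (1 - exp (X t \<omega> - drift * t)))"
      by (auto simp: max_def mult_nonneg_nonneg mult_le_0_iff zero_le_mult_iff)
    with le show "max 0 (1 + d * t - exp (q * t + X t \<omega>)) \<le> (1 + d * t) * max 0 (1 - exp (X t \<omega> - drift * t))"
      by simp
  qed
  also have "\<dots> = (1 + d * t) * (\<integral>x. max 0 (1 - exp x) \<partial>jump_law t)"
    unfolding jump_law_def by (subst integral_distr) auto
  also have "\<dots> \<le> (1 + d * t) * (t * (\<integral>y. max 0 (1 - exp y) \<partial>\<nu>))"
    using J d t by (intro mult_left_mono) auto
  finally show ?thesis .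
qed

text \<open>As \<open>l\<close> lies strictly below the limit, the strike may be lowered by a small
  \<open>\<eta>\<close> with the integral still above \<open>l\<close>. For fixed
  \<open>\<eta>\<close> the superadditivity error is of order \<open>t^2\<close>, and
  \<open>\<eta>\<close> also pays for the factor \<open>exp ((q + drift) * t)\<close>.\<close>

lemma eventually_integral_payoff_ge:
  assumes l: "l < (\<integral>y. max 0 (1 - exp y) \<partial>\<nu>)"
  shows "eventually (\<lambda>t. l * t \<le> (\<integral>\<omega>. max 0 (1 - exp (q * t + X t \<omega>)) \<partial>M)) (at_right 0)"
proof -
  have "(\<lambda>n. \<integral>y. max 0 (1 - 1 / real (Suc n) - exp y) \<partial>\<nu>) \<longlonglongrightarrow> (\<integral>y. max 0 (1 - exp y) \<partial>\<nu>)"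
  proof (rule integral_dominated_convergence[OF _ _ integrable_payoff])
    show "AE y in \<nu>. (\<lambda>n. max 0 (1 - 1 / real (Suc n) - exp y)) \<longlonglongrightarrow> max 0 (1 - exp y)"
    proof (rule AE_I2)
      fix y :: real
      have "(\<lambda>n. max 0 (1 - 1 / real (Suc n) - exp y)) \<longlonglongrightarrow> max 0 (1 - 0 - exp y)"
        by (intro tendsto_intros LIMSEQ_Suc[OF lim_1_over_n])
      then show "(\<lambda>n. max 0 (1 - 1 / real (Suc n) - exp y)) \<longlonglongrightarrow> max 0 (1 - exp y)" by simp
    qed
    show "AE y in \<nu>. norm (max 0 (1 - 1 / real (Suc n) - exp y)) \<le> max 0 (1 - exp y)" for n
      by (intro AE_I2) (simp add: max.coboundedI2)
  qed auto
  from order_tendstoD(1)[OF this l] obtain n where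
    n: "l < (\<integral>y. max 0 (1 - 1 / real (Suc n) - exp y) \<partial>\<nu>)"
    by (auto simp: eventually_sequentially)
  define \<eta> where "\<eta> = 1 / real (Suc n)"
  have \<eta>: "0 < \<eta>" "\<eta> \<le> 1" by (auto simp: \<eta>_def)
  define I where "I = (\<integral>y. max 0 (1 - \<eta> - exp y) \<partial>\<nu>)"
  define W where "W = (\<integral>y. min 1 \<bar>y\<bar> \<partial>\<nu>)"
  have "((\<lambda>t. I - 2 / \<eta> * t * W\<^sup>2) \<longlongrightarrow> I - 2 / \<eta> * 0 * W\<^sup>2) (at_right 0)"
    by (intro tendsto_intros)
  then have ev1: "eventually (\<lambda>t. l < I - 2 / \<eta> * t * W\<^sup>2) (at_right 0)"
    by (rule order_tendstoD) (use n in \<open>simp add: I_def \<eta>_def\<close>)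
  have "((\<lambda>t. exp ((q + drift) * t) - 1) \<longlongrightarrow> exp ((q + drift) * 0) - 1) (at_right 0)"
    by (intro tendsto_intros)
  then have ev2: "eventually (\<lambda>t. exp ((q + drift) * t) - 1 < \<eta>) (at_right 0)"
    by (rule order_tendstoD) (use \<eta> in simp)
  have ev3: "eventually (\<lambda>t::real. 0 < t) (at_right 0)" by (rule eventually_at_right_less)
  from ev1 ev2 ev3 show ?thesis
  proof eventually_elim
    case (elim t)
    have "l * t \<le> (I - 2 / \<eta> * t * W\<^sup>2) * t" using elim by (intro mult_right_mono) auto
    also have "\<dots> = t * I - 2 / \<eta> * (t * W)\<^sup>2" by (simp add: power2_eq_square algebra_simps)
    also have "\<dots> \<le> (\<integral>x. max 0 (1 - \<eta> - exp x) \<partial>jump_law t)"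
      unfolding I_def W_def
    proof (rule jump_law_integral_ge[where B=1])
      show "\<bar>max 0 (1 - \<eta> - exp x)\<bar> \<le> 1 * min 1 \<bar>x\<bar>" for x
      proof -
        have "\<bar>max 0 (1 - \<eta> - exp x)\<bar> \<le> max 0 (1 - exp x)" using \<eta> by (simp add: max.coboundedI2)
        then show ?thesis using max_one_minus_exp_le[of x] by linarith
      qed
      show "isCont (\<lambda>y. max 0 (1 - \<eta> - exp y)) x" for x
        by (intro continuous_intros)
    qed (use elim \<eta> max_truncated_payoff_superadditive[OF \<eta>] in auto)
    also have "\<dots> = (\<integral>\<omega>. max 0 (1 - \<eta> - exp (X t \<omega> - drift * t)) \<partial>M)"
      unfolding jump_law_def by (subst integral_distr) auto
    also have "\<dots> \<le> (\<integral>\<omega>. max 0 (1 - exp (q * t + X t \<omega>)) \<partial>M)"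
    proof (rule integral_mono)
      show "integrable M (\<lambda>\<omega>. max 0 (1 - \<eta> - exp (X t \<omega> - drift * t)))"
      proof (rule integrable_const_bound[where B=1])
        have "norm (max 0 (1 - \<eta> - exp z)) \<le> 1" for z :: real
          unfolding real_norm_def using \<eta> exp_gt_zero[of z] by linarith
        then show "AE \<omega> in M. norm (max 0 (1 - \<eta> - exp (X t \<omega> - drift * t))) \<le> 1" by simp
      qed simp
      show "integrable M (\<lambda>\<omega>. max 0 (1 - exp (q * t + X t \<omega>)))"
        by (intro integrable_const_bound[where B=1]) auto
      fix \<omega>
      define e where "e = exp (X t \<omega> - drift * t)"
      have e0: "0 < e" by (simp add: e_def)
      have "exp (q * t + X t \<omega>) = exp ((q + drift) * t) * e"
        by (simp add: e_def exp_add[symmetric] algebra_simps)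
      \<comment> \<open>Where the truncated payoff is positive, \<open>e \<le> 1\<close>, and there
        the drift changes the price by at most \<open>\<eta>\<close>.\<close>
      moreover have "1 - \<eta> - e \<le> 1 - exp ((q + drift) * t) * e" if "e \<le> 1"
      proof -
        have "(exp ((q + drift) * t) - 1) * e \<le> \<eta> * e" using elim e0 by (intro mult_right_mono) auto
        also have "\<dots> \<le> \<eta>" using that \<eta> by (simp add: mult_left_le)
        finally show ?thesis by (simp add: algebra_simps)
      qed
      ultimately show "max 0 (1 - \<eta> - exp (X t \<omega> - drift * t)) \<le> max 0 (1 - exp (q * t + X t \<omega>))"
        using \<eta> by (cases "e \<le> 1") (auto simp: e_def[symmetric] max_def)
    qed
    finally show ?case .
  qed
qed

end

section \<open>Independence of increments from the augmented past\<close>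

context levy_space
begin

definition past :: "real \<Rightarrow> 'a set set" where
  "past q = {X u -` B \<inter> space M | u B. 0 \<le> u \<and> u \<le> q \<and> B \<in> sets borel}"

text \<open>Finite-dimensional events. They are closed under intersection, which the generators in
  \<open>past\<close> need not be, as Dynkin's argument for independence requires.\<close>

definition cylinders :: "real \<Rightarrow> 'a set set" where
  "cylinders q = {{\<omega> \<in> space M. \<forall>u\<in>F. X u \<omega> \<in> B u} | F B.
     finite F \<and> F \<subseteq> {0..q} \<and> (\<forall>u\<in>F. B u \<in> sets borel)}"

lemma past_subset_Pow: "past q \<subseteq> Pow (space M)"
  by (auto simp: past_def)

lemma past_subset_cylinders: "past q \<subseteq> cylinders q"
proof
  fix A assume "A \<in> past q"
  then obtain u B where "A = X u -` B \<inter> space M" "0 \<le> u" "u \<le> q" "B \<in> sets borel"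
    by (auto simp: past_def)
  then show "A \<in> cylinders q"
    unfolding cylinders_def by (intro CollectI exI[of _ "{u}"] exI[of _ "\<lambda>_. B"]) auto
qed

lemma Int_stable_cylinders: "Int_stable (cylinders q)"
proof (rule Int_stableI)
  fix A A' assume "A \<in> cylinders q" "A' \<in> cylinders q"
  then obtain F B F' B' where
    A: "A = {\<omega> \<in> space M. \<forall>u\<in>F. X u \<omega> \<in> B u}" "finite F" "F \<subseteq> {0..q}" "\<And>u. u \<in> F \<Longrightarrow> B u \<in> sets borel" and
    A': "A' = {\<omega> \<in> space M. \<forall>u\<in>F'. X u \<omega> \<in> B' u}" "finite F'" "F' \<subseteq> {0..q}" "\<And>u. u \<in> F' \<Longrightarrow> B' u \<in> sets borel"
    unfolding cylinders_def by blast
  define C where "C u = (if u \<in> F then B u else UNIV) \<inter> (if u \<in> F' then B' u else UNIV)" for u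
  have "A \<inter> A' = {\<omega> \<in> space M. \<forall>u\<in>F \<union> F'. X u \<omega> \<in> C u}"
    by (auto simp: A A' C_def)
  moreover have "\<forall>u\<in>F \<union> F'. C u \<in> sets borel"
    using A(4) A'(4) by (auto simp: C_def)
  ultimately show "A \<inter> A' \<in> cylinders q"
    unfolding cylinders_def using A A' by (intro CollectI exI[of _ "F \<union> F'"] exI[of _ C]) auto
qed

lemma cylinder_in_events: "A \<in> cylinders q \<Longrightarrow> A \<in> events"
  unfolding cylinders_def by (auto intro!: sets.sets_Collect_finite_All)

text \<open>Along a time grid through the times of the cylinder, \<open>q\<close> and
  \<open>q + e\<close>, the two events depend on disjoint blocks of independent increments.\<close>

lemma prob_cylinder_increment:
  assumes q: "0 \<le> q" and e: "0 \<le> e" and C: "C \<in> cylinders q" and D: "D \<in> sets borel"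
  defines "E \<equiv> (\<lambda>\<omega>. X (q + e) \<omega> - X q \<omega>) -` D \<inter> space M"
  shows "prob (C \<inter> E) = prob C * prob E"
proof -
  from C obtain F B where C_eq: "C = {\<omega> \<in> space M. \<forall>u\<in>F. X u \<omega> \<in> B u}"
    and F: "finite F" "F \<subseteq> {0..q}" and B: "\<And>u. u \<in> F \<Longrightarrow> B u \<in> sets borel"
    unfolding cylinders_def by blast
  define us where "us = sorted_list_of_set F"
  define n where "n = length us"
  have us: "set us = F" "sorted us" using F by (auto simp: us_def)
  \<comment> \<open>The grid is 0, the \<open>n\<close> sorted times of \<open>F\<close>, then
    \<open>q\<close>, then \<open>q + e\<close>. Increments \<open>0\<close> to \<open>n\<close> lie
    before \<open>q\<close>; increment \<open>Suc n\<close> runs from \<open>q\<close> to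
    \<open>q + e\<close>.\<close>
  define ts where "ts i = (if i = 0 then 0 else if i \<le> n then us ! (i - 1) else if i = Suc n then q else q + e)" for i
  have us_in: "us ! i \<in> {0..q}" if "i < n" for i
    using that us(1) F(2) nth_mem[of i us] unfolding n_def by blast
  have mono: "ts i \<le> ts (Suc i)" if i: "i < Suc (Suc n)" for i
  proof -
    consider "i = 0" | "0 < i" "i < n" | "0 < i" "i = n" | "0 < i" "i = Suc n" using i by linarith
    then show ?thesis
    proof cases
      case 1 then show ?thesis using us_in[of 0] q by (auto simp: ts_def)
    next
      case 2 then show ?thesis using sorted_nth_mono[OF us(2), of "i - 1" i] by (auto simp: ts_def n_def)
    next
      case 3 then show ?thesis using us_in[of "i - 1"] by (auto simp: ts_def)
    next
      case 4 then show ?thesis using e by (auto simp: ts_def)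
    qed
  qed
  define incr where "incr i \<omega> = X (ts (Suc i)) \<omega> - X (ts i) \<omega>" for i \<omega>
  have "indep_vars (\<lambda>_. borel) incr {..<Suc (Suc n)}"
    unfolding incr_def using mono by (intro X_increments_indep) (auto simp: ts_def)
  then have ind: "indep_var (PiM {..<Suc n} (\<lambda>_. borel)) (\<lambda>\<omega>. restrict (\<lambda>i. incr i \<omega>) {..<Suc n})
      (PiM {Suc n} (\<lambda>_. borel)) (\<lambda>\<omega>. restrict (\<lambda>i. incr i \<omega>) {Suc n})"
    by (rule indep_var_restrict) auto
  \<comment> \<open>As \<open>X\<close> starts at 0, its value at a grid time is the sum of the
    earlier increments; this rewrites the cylinder as an event of the first block.\<close>
  have X_sum: "X (ts k) \<omega> = (\<Sum>i<k. incr i \<omega>)" if "\<omega> \<in> space M" for k \<omega>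
  proof -
    have "ts 0 = 0" by (simp add: ts_def)
    with sum_lessThan_telescope[of "\<lambda>i. X (ts i) \<omega>" k] X_0[OF that] show ?thesis
      by (simp add: incr_def)
  qed
  have "\<exists>k. k \<le> n \<and> u = ts k" if "u \<in> F" for u
  proof -
    from that us(1) obtain i where "i < n" "u = us ! i" by (auto simp: n_def in_set_conv_nth)
    then show ?thesis by (intro exI[of _ "Suc i"]) (auto simp: ts_def)
  qed
  then obtain k where k: "\<And>u. u \<in> F \<Longrightarrow> k u \<le> n" "\<And>u. u \<in> F \<Longrightarrow> u = ts (k u)" by metis
  define SA where "SA = {x \<in> space (PiM {..<Suc n} (\<lambda>_. borel)). \<forall>u\<in>F. (\<Sum>i<k u. x i) \<in> B u}"
  define SB where "SB = {x \<in> space (PiM {Suc n} (\<lambda>_. borel)). x (Suc n) \<in> D}"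
  have [measurable]: "(\<lambda>x. \<Sum>i<k u. x i) \<in> borel_measurable (PiM {..<Suc n} (\<lambda>_. borel :: real measure))" if "u \<in> F" for u
  proof -
    have "(\<lambda>x. x i) \<in> borel_measurable (PiM {..<Suc n} (\<lambda>_. borel :: real measure))" if "i \<in> {..<k u}" for i
      using that k(1)[OF \<open>u \<in> F\<close>] by (intro measurable_component_singleton) auto
    from borel_measurable_sum[of "{..<k u}" "\<lambda>i x. x i", OF this] show ?thesis by simp
  qed
  have SA: "SA \<in> sets (PiM {..<Suc n} (\<lambda>_. borel))"
    unfolding SA_def using B by (intro sets.sets_Collect_finite_All F) (auto intro: measurable_sets_Collect)
  have SB: "SB \<in> sets (PiM {Suc n} (\<lambda>_. borel))"
    unfolding SB_def using D by measurable
  have rsp: "restrict (\<lambda>i. incr i \<omega>) S \<in> space (PiM S (\<lambda>_. borel))" for \<omega> S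
    by (simp add: space_PiM)
  have "C = (\<lambda>\<omega>. restrict (\<lambda>i. incr i \<omega>) {..<Suc n}) -` SA \<inter> space M"
  proof -
    have "(\<Sum>i<k u. restrict (\<lambda>i. incr i \<omega>) {..<Suc n} i) = X u \<omega>" if "u \<in> F" "\<omega> \<in> space M" for u \<omega>
      using k[OF that(1)] X_sum[OF that(2), of "k u"] by (auto intro!: sum.cong)
    then show ?thesis unfolding C_eq SA_def using rsp by auto
  qed
  moreover have "E = (\<lambda>\<omega>. restrict (\<lambda>i. incr i \<omega>) {Suc n}) -` SB \<inter> space M"
    using rsp[of _ "{Suc n}"] unfolding E_def SB_def by (auto simp: incr_def ts_def)
  moreover have "C \<inter> E = (\<lambda>\<omega>. (restrict (\<lambda>i. incr i \<omega>) {..<Suc n}, restrict (\<lambda>i. incr i \<omega>) {Suc n})) -` (SA \<times> SB) \<inter> space M"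
    unfolding calculation by auto
  ultimately show ?thesis using indep_varD[OF ind SA SB] by simp
qed

text \<open>The product formula on cylinders extends to the generated sigma-algebras because both
  generating classes are closed under intersection.\<close>

lemma indep_set_past_increment:
  assumes "0 \<le> q" "0 \<le> e"
  shows "indep_set (sigma_sets (space M) (past q))
    (sigma_sets (space M) {(\<lambda>\<omega>. X (q + e) \<omega> - X q \<omega>) -` D \<inter> space M | D. D \<in> sets borel})"
proof -
  let ?E = "{(\<lambda>\<omega>. X (q + e) \<omega> - X q \<omega>) -` D \<inter> space M | D. D \<in> sets borel}"
  have "indep_set (sigma_sets (space M) (cylinders q)) (sigma_sets (space M) ?E)"
  proof (rule indep_set_sigma_sets[OF _ Int_stable_cylinders])
    show "indep_set (cylinders q) ?E"
      unfolding indep_sets2_eq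
    proof (intro conjI ballI)
      show "cylinders q \<subseteq> events" using cylinder_in_events by blast
      show "?E \<subseteq> events" by auto
      fix a b assume "a \<in> cylinders q" "b \<in> ?E"
      then show "prob (a \<inter> b) = prob a * prob b"
        using prob_cylinder_increment[OF assms] by auto
    qed
    show "Int_stable ?E"
    proof (rule Int_stableI)
      fix a b assume "a \<in> ?E" "b \<in> ?E"
      then obtain A B where "A \<in> sets borel" "B \<in> sets borel"
        "a = (\<lambda>\<omega>. X (q + e) \<omega> - X q \<omega>) -` A \<inter> space M" "b = (\<lambda>\<omega>. X (q + e) \<omega> - X q \<omega>) -` B \<inter> space M"
        by blast
      then show "a \<inter> b \<in> ?E" by (intro CollectI exI[of _ "A \<inter> B"]) auto
    qed
  qed
  moreover have "sigma_sets (space M) (past q) \<subseteq> sigma_sets (space M) (cylinders q)"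
    by (intro sigma_sets_mono' past_subset_cylinders)
  ultimately show ?thesis unfolding indep_sets2_eq by blast
qed

text \<open>Lets independence, proved for the raw past, be used for the past augmented by null sets.
  Countable unions survive because countably many exceptional null sets form a null set.\<close>

lemma augmented_sets_AE_eq:
  assumes "A \<in> sigma_sets (space M) (G \<union> null_sets (completion M))"
  shows "\<exists>A'\<in>sigma_sets (space M) G. AE \<omega> in M. \<omega> \<in> A \<longleftrightarrow> \<omega> \<in> A'"
  using assms
proof induction
  case (Basic a)
  show ?case
  proof (cases "a \<in> G")
    case True
    then show ?thesis by (intro bexI[of _ a]) (auto intro: sigma_sets.Basic)
  next
    case False
    with Basic have "a \<in> null_sets (completion M)" by simp
    then have "AE \<omega> in completion M. \<omega> \<notin> a" by (rule AE_not_in)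
    then have "AE \<omega> in M. \<omega> \<notin> a" unfolding AE_completion_iff .
    then show ?thesis by (intro bexI[of _ "{}"]) (auto intro: sigma_sets.Empty)
  qed
next
  case Empty
  then show ?case by (intro bexI[of _ "{}"]) (auto intro: sigma_sets.Empty)
next
  case (Compl a)
  then obtain A' where A': "A' \<in> sigma_sets (space M) G" "AE \<omega> in M. \<omega> \<in> a \<longleftrightarrow> \<omega> \<in> A'" by blast
  from A'(2) have "AE \<omega> in M. \<omega> \<in> space M - a \<longleftrightarrow> \<omega> \<in> space M - A'" by eventually_elim auto
  with A'(1) show ?case by (blast intro: sigma_sets.Compl)
next
  case (Union a)
  then obtain A' where A': "\<And>i. A' i \<in> sigma_sets (space M) G" "\<And>i. AE \<omega> in M. \<omega> \<in> a i \<longleftrightarrow> \<omega> \<in> A' i"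
    by metis
  from A'(2) have "AE \<omega> in M. \<forall>i::nat. \<omega> \<in> a i \<longleftrightarrow> \<omega> \<in> A' i" by (simp add: AE_all_countable)
  then have "AE \<omega> in M. \<omega> \<in> (\<Union>i. a i) \<longleftrightarrow> \<omega> \<in> (\<Union>i. A' i)" by eventually_elim auto
  with A'(1) show ?case by (blast intro: sigma_sets.Union)
qed

lemma augmented_past_completion:
  "sigma_sets (space M) (past q \<union> null_sets (completion M)) \<subseteq> sets (completion M)"
proof -
  have "sigma_sets (space (completion M)) (past q \<union> null_sets (completion M)) \<subseteq> sets (completion M)"
    by (rule sets.sigma_sets_subset) (auto simp: past_def null_setsD2)
  then show ?thesis by simp
qed

text \<open>The strict inequality removes the right limit in the filtration:
  \<open>\<tau> < q\<close> is the union of the events \<open>\<tau> \<le> q - 1 / Suc n\<close>,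
  each known at a time before \<open>q\<close>, where the right limit still lies inside the past up
  to \<open>q\<close>.\<close>

lemma stopping_time_less_in_augmented_past:
  assumes \<tau>: "\<tau> \<in> stopping_times_upto M X s"
  shows "{\<omega> \<in> space M. \<tau> \<omega> < q} \<in> sigma_sets (space M) (past q \<union> null_sets (completion M))"
proof -
  let ?S = "sigma_sets (space M) (past q \<union> null_sets (completion M))"
  have sub: "sets (levy_filtration M X t) \<subseteq> ?S" if "t < q" for t
  proof -
    let ?G = "\<lambda>s. sigma_sets (space M)
        ({X u -` B \<inter> space M | u B. 0 \<le> u \<and> u \<le> s \<and> B \<in> sets borel} \<union> null_sets (completion M))"
    have Gq: "?G q = ?S" by (simp add: past_def)
    have I: "(\<Inter>s\<in>{t<..}. ?G s) \<subseteq> ?S"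
      using that by (subst Gq[symmetric]) (rule INF_lower, simp)
    have GP: "past q \<union> null_sets (completion M) \<subseteq> Pow (space M)"
      using past_subset_Pow[of q] sets.sets_into_space[of _ "completion M"] by auto
    then have SP: "?S \<subseteq> Pow (space M)"
      using sigma_sets_into_sp[OF GP] by blast
    \<comment> \<open>\<open>sigma\<close> generates from a family only if its members are subsets
      of the space, which \<open>I\<close> and \<open>SP\<close> provide.\<close>
    have "sets (levy_filtration M X t) = sigma_sets (space M) (\<Inter>s\<in>{t<..}. ?G s)"
      unfolding levy_filtration_def by (rule sets_measure_of[OF order_trans[OF I SP]])
    also have "\<dots> \<subseteq> sigma_sets (space M) ?S" by (rule sigma_sets_mono'[OF I])
    also have "\<dots> = ?S" by (rule sigma_sets_sigma_sets_eq[OF GP])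
    finally show ?thesis .
  qed
  have "{\<omega> \<in> space M. \<tau> \<omega> < q} = (\<Union>n::nat. {\<omega> \<in> space M. \<tau> \<omega> \<le> q - 1 / real (Suc n)})"
  proof (intro set_eqI iffI)
    fix \<omega> assume "\<omega> \<in> {\<omega> \<in> space M. \<tau> \<omega> < q}"
    then have "\<omega> \<in> space M" "0 < q - \<tau> \<omega>" by auto
    moreover from this(2) obtain n where "1 / real (Suc n) < q - \<tau> \<omega>"
      using reals_Archimedean[of "q - \<tau> \<omega>"] by (auto simp: inverse_eq_divide)
    ultimately show "\<omega> \<in> (\<Union>n::nat. {\<omega> \<in> space M. \<tau> \<omega> \<le> q - 1 / real (Suc n)})"
      by (auto intro!: exI[of _ n])
  next
    fix \<omega> assume "\<omega> \<in> (\<Union>n::nat. {\<omega> \<in> space M. \<tau> \<omega> \<le> q - 1 / real (Suc n)})"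
    then obtain n where "\<omega> \<in> space M" "\<tau> \<omega> \<le> q - 1 / real (Suc n)" by blast
    moreover have "0 < 1 / real (Suc n)" by simp
    ultimately have "\<omega> \<in> space M" "\<tau> \<omega> < q" by linarith+
    then show "\<omega> \<in> {\<omega> \<in> space M. \<tau> \<omega> < q}" by simp
  qed
  also have "\<dots> \<in> ?S"
  proof (rule sigma_sets.Union)
    fix n :: nat
    have "Measurable.pred (levy_filtration M X (q - 1 / real (Suc n))) (\<lambda>\<omega>. \<tau> \<omega> \<le> q - 1 / real (Suc n))"
      using \<tau> unfolding stopping_times_upto_def by (auto intro: stopping_timeD)
    then have "{\<omega> \<in> space M. \<tau> \<omega> \<le> q - 1 / real (Suc n)} \<in> sets (levy_filtration M X (q - 1 / real (Suc n)))"
      by (simp add: pred_def levy_filtration_def space_measure_of_conv)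
    also have "\<dots> \<subseteq> ?S" by (rule sub) simp
    finally show "{\<omega> \<in> space M. \<tau> \<omega> \<le> q - 1 / real (Suc n)} \<in> ?S" .
  qed
  finally show ?thesis .
qed

text \<open>The one-step inequality \<open>step\<close>, conditional on an event of the past.
  Independence and stationarity make the joint law of the past data and the increment a product with
  factor the law of \<open>X e\<close>, and Fubini applies \<open>step\<close> for each frozen value
  of \<open>X q\<close>.\<close>

lemma integral_step_le:
  fixes \<Phi> \<Psi> :: "real \<Rightarrow> real"
  assumes q: "0 \<le> q" and e: "0 \<le> e"
    and \<Phi>[measurable]: "\<Phi> \<in> borel_measurable borel" and \<Psi>[measurable]: "\<Psi> \<in> borel_measurable borel"
    and \<Phi>_bd: "\<And>x. \<bar>\<Phi> x\<bar> \<le> B" and \<Psi>_bd: "\<And>x. \<bar>\<Psi> x\<bar> \<le> B"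
    and step: "\<And>x. (\<integral>\<omega>. \<Psi> (x + X e \<omega>) \<partial>M) \<le> \<Phi> x"
    and A: "A \<in> sigma_sets (space M) (past q \<union> null_sets (completion M))"
  shows "(\<integral>\<omega>. indicator A \<omega> * \<Psi> (X (q + e) \<omega>) \<partial>completion M)
       \<le> (\<integral>\<omega>. indicator A \<omega> * \<Phi> (X q \<omega>) \<partial>completion M)"
proof -
  obtain A' where A': "A' \<in> sigma_sets (space M) (past q)" and AE: "AE \<omega> in M. \<omega> \<in> A \<longleftrightarrow> \<omega> \<in> A'"
    using augmented_sets_AE_eq[OF A] by blast
  define N where "N = sigma (space M) (past q)"
  have setsN: "sets N = sigma_sets (space M) (past q)" and spaceN: "space N = space M"
    unfolding N_def using past_subset_Pow[of q] by (auto simp: sets_measure_of space_measure_of)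
  have N_sub: "sets N \<subseteq> events"
    unfolding setsN by (rule sets.sigma_sets_subset) (auto simp: past_def)
  have A'M[measurable]: "A' \<in> events" using A' N_sub setsN by blast
  have A_compl: "A \<in> sets (completion M)" using A augmented_past_completion by blast
  have to_M: "(\<integral>\<omega>. indicator A \<omega> * f (X u \<omega>) \<partial>completion M) = (\<integral>\<omega>. indicator A' \<omega> * f (X u \<omega>) \<partial>M)"
    if [measurable]: "f \<in> borel_measurable borel" for f :: "real \<Rightarrow> real" and u
  proof -
    have "(\<integral>\<omega>. indicator A \<omega> * f (X u \<omega>) \<partial>completion M) = (\<integral>\<omega>. indicator A' \<omega> * f (X u \<omega>) \<partial>completion M)"
    proof (rule integral_cong_AE)
      show "(\<lambda>\<omega>. indicator A \<omega> * f (X u \<omega>)) \<in> borel_measurable (completion M)"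
        using A_compl by (intro borel_measurable_times borel_measurable_indicator measurable_completion) auto
      show "(\<lambda>\<omega>. indicator A' \<omega> * f (X u \<omega>)) \<in> borel_measurable (completion M)"
        by (intro measurable_completion) measurable
      from AE_completion[OF AE]
      show "AE \<omega> in completion M. indicator A \<omega> * f (X u \<omega>) = indicator A' \<omega> * f (X u \<omega>)"
        by eventually_elim (auto simp: indicator_def)
    qed
    also have "\<dots> = (\<integral>\<omega>. indicator A' \<omega> * f (X u \<omega>) \<partial>M)"
      by (rule integral_completion) measurable
    finally show ?thesis .
  qed
  \<comment> \<open>Pairing the indicator with \<open>X q\<close> requires a single independence
    statement for both.\<close>
  define Z where "Z \<omega> = (indicator A' \<omega> :: real, X q \<omega>)" for \<omega>
  define \<Delta> where "\<Delta> \<omega> = X (q + e) \<omega> - X q \<omega>" for \<omega>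
  have [measurable]: "\<Delta> \<in> borel_measurable M" unfolding \<Delta>_def by measurable
  have ZN: "Z \<in> measurable N (borel \<Otimes>\<^sub>M borel)"
  proof -
    have [measurable]: "A' \<in> sets N" using A' setsN by simp
    have [measurable]: "X q \<in> borel_measurable N"
      using q by (intro measurableI) (auto simp: setsN spaceN past_def intro!: sigma_sets.Basic)
    show ?thesis unfolding Z_def by measurable
  qed
  have [measurable]: "Z \<in> measurable M (borel \<Otimes>\<^sub>M borel)" unfolding Z_def by measurable
  define L where "L = distr M borel (X e)"
  have L\<Delta>: "distr M borel \<Delta> = L"
    unfolding L_def \<Delta>_def using X_increments_stationary[of q "q + e"] q e by simp
  define Q where "Q = distr M (borel \<Otimes>\<^sub>M borel) Z"
  interpret Q: prob_space Q unfolding Q_def by (rule prob_space_distr) measurable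
  interpret L: real_distribution L
    unfolding L_def by (intro real_distribution.intro prob_space_distr real_distribution_axioms.intro) auto
  have joint: "Q \<Otimes>\<^sub>M L = distr M ((borel \<Otimes>\<^sub>M borel) \<Otimes>\<^sub>M borel) (\<lambda>\<omega>. (Z \<omega>, \<Delta> \<omega>))"
  proof (rule pair_measure_eqI)
    show "sigma_finite_measure Q" "sigma_finite_measure L" by unfold_locales
    show "sets (Q \<Otimes>\<^sub>M L) = sets (distr M ((borel \<Otimes>\<^sub>M borel) \<Otimes>\<^sub>M borel) (\<lambda>\<omega>. (Z \<omega>, \<Delta> \<omega>)))"
      by (simp add: Q_def L_def cong: sets_pair_measure_cong)
    fix S D assume "S \<in> sets Q" "D \<in> sets L"
    then have [measurable]: "S \<in> sets (borel \<Otimes>\<^sub>M borel)" "D \<in> sets borel" by (auto simp: Q_def L_def)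
    have "Z -` S \<inter> space M \<in> sigma_sets (space M) (past q)"
      using measurable_sets[OF ZN, of S] unfolding setsN spaceN by simp
    moreover have "\<Delta> -` D \<inter> space M \<in> sigma_sets (space M) {(\<lambda>\<omega>. X (q + e) \<omega> - X q \<omega>) -` D \<inter> space M | D. D \<in> sets borel}"
      unfolding \<Delta>_def by (intro sigma_sets.Basic) auto
    ultimately have "prob ((Z -` S \<inter> space M) \<inter> (\<Delta> -` D \<inter> space M)) = prob (Z -` S \<inter> space M) * prob (\<Delta> -` D \<inter> space M)"
      using indep_set_past_increment[OF q e] unfolding indep_sets2_eq by blast
    moreover have "(\<lambda>\<omega>. (Z \<omega>, \<Delta> \<omega>)) -` (S \<times> D) \<inter> space M = (Z -` S \<inter> space M) \<inter> (\<Delta> -` D \<inter> space M)"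
      by auto
    ultimately show "emeasure Q S * emeasure L D = emeasure (distr M ((borel \<Otimes>\<^sub>M borel) \<Otimes>\<^sub>M borel) (\<lambda>\<omega>. (Z \<omega>, \<Delta> \<omega>))) (S \<times> D)"
      unfolding Q_def L\<Delta>[symmetric]
      by (simp add: emeasure_distr emeasure_eq_measure ennreal_mult[symmetric])
  qed
  interpret QL: pair_prob_space Q L ..
  have [measurable_cong]: "sets Q = sets (borel \<Otimes>\<^sub>M borel)" "sets L = sets borel"
    by (auto simp: Q_def L_def)
  \<comment> \<open>The first coordinate is an indicator: it keeps the integrands bounded by
    \<open>B\<close> and, being nonnegative, preserves the inequality \<open>step\<close>.\<close>
  have AEZ: "AE z in Q. fst z = 0 \<or> fst z = 1"
    unfolding Q_def by (subst AE_distr_iff) (auto simp: Z_def indicator_def)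
  have B0: "0 \<le> B" using \<Phi>_bd[of 0] by linarith
  have "(\<integral>\<omega>. indicator A' \<omega> * \<Psi> (X (q + e) \<omega>) \<partial>M)
      = (\<integral>\<omega>. (\<lambda>(z, y). fst z * \<Psi> (snd z + y)) (Z \<omega>, \<Delta> \<omega>) \<partial>M)"
    by (simp add: Z_def \<Delta>_def)
  also have "\<dots> = (\<integral>p. (\<lambda>(z, y). fst z * \<Psi> (snd z + y)) p \<partial>(Q \<Otimes>\<^sub>M L))"
    unfolding joint by (rule integral_distr[symmetric]) measurable
  also have "\<dots> = (\<integral>z. \<integral>y. fst z * \<Psi> (snd z + y) \<partial>L \<partial>Q)"
  proof (subst QL.integral_fst'[symmetric])
    have "AE p in Q \<Otimes>\<^sub>M L. fst (fst p) = 0 \<or> fst (fst p) = 1"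
      unfolding joint by (subst AE_distr_iff) (auto simp: Z_def indicator_def)
    then show "integrable (Q \<Otimes>\<^sub>M L) (\<lambda>(z, y). fst z * \<Psi> (snd z + y))"
      using \<Psi>_bd B0 by (intro QL.integrable_const_bound[where B=B]) (auto elim!: eventually_mono simp: case_prod_beta)
  qed simp
  also have "\<dots> \<le> (\<integral>z. fst z * \<Phi> (snd z) \<partial>Q)"
  proof (rule integral_mono_AE)
    have "\<bar>\<integral>y. \<Psi> (x + y) \<partial>L\<bar> \<le> B" for x
      using L.norm_integral_bounded[of "\<lambda>y. \<Psi> (x + y)" B] \<Psi>_bd by simp
    with AEZ B0 show "integrable Q (\<lambda>z. \<integral>y. fst z * \<Psi> (snd z + y) \<partial>L)"
      by (intro Q.integrable_const_bound[where B=B]) (auto elim!: eventually_mono)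
    show "integrable Q (\<lambda>z. fst z * \<Phi> (snd z))"
      using AEZ B0 \<Phi>_bd by (intro Q.integrable_const_bound[where B=B]) (auto elim!: eventually_mono)
    have "(\<integral>y. \<Psi> (x + y) \<partial>L) \<le> \<Phi> x" for x
      unfolding L_def using step[of x] by (subst integral_distr) auto
    with AEZ show "AE z in Q. (\<integral>y. fst z * \<Psi> (snd z + y) \<partial>L) \<le> fst z * \<Phi> (snd z)"
      by (auto elim!: eventually_mono)
  qed
  also have "\<dots> = (\<integral>\<omega>. indicator A' \<omega> * \<Phi> (X q \<omega>) \<partial>M)"
    unfolding Q_def by (subst integral_distr) (auto simp: Z_def)
  finally show ?thesis unfolding to_M[OF \<Psi>] to_M[OF \<Phi>] .
qed

end

section \<open>Optional stopping by discretisation\<close>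

context levy_space
begin

text \<open>A stopping time \<open>\<tau> \<le> s\<close> is approximated from the right by the times \<open>(s/n) min n (\<lfloor>n\<tau>/s\<rfloor> + 1)\<close>.
  Rounding up strictly makes the discretised time a stopping time of the filtration without the
  right limit, so that independence of the increments applies directly.\<close>

lemma grid_stopping_le:
  fixes U :: "real \<Rightarrow> real \<Rightarrow> real"
  assumes s: "0 < s" and \<tau>: "\<tau> \<in> stopping_times_upto M X s"
    and U[measurable]: "\<And>u. U u \<in> borel_measurable borel" and U_bd: "\<And>u x. \<bar>U u x\<bar> \<le> B"
    and n: "0 < n"
  defines "idx \<equiv> \<lambda>\<omega>. min n (Suc (nat \<lfloor>real n * \<tau> \<omega> / s\<rfloor>))"
  shows "(\<lambda>\<omega>. U (s / n * idx \<omega>) (X (s / n * idx \<omega>) \<omega>)) \<in> borel_measurable (completion M)"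
    and "(\<And>u e x. 0 \<le> u \<Longrightarrow> 0 < e \<Longrightarrow> u + e \<le> s \<Longrightarrow> (\<integral>\<omega>. U (u + e) (x + X e \<omega>) \<partial>M) \<le> U u x) \<Longrightarrow>
      (\<integral>\<omega>. U (s / n * idx \<omega>) (X (s / n * idx \<omega>) \<omega>) \<partial>completion M) \<le> U 0 0"
proof -
  interpret C: prob_space "completion M" by (rule prob_space_completion)
  define e where "e = s / n"
  have e: "0 < e" using s n by (simp add: e_def)
  define A where "A k = {\<omega> \<in> space M. \<not> \<tau> \<omega> < real k * e}" for k :: nat
  have A: "A k \<in> sigma_sets (space M) (past (real k * e) \<union> null_sets (completion M))" for k
  proof -
    have "A k = space M - {\<omega> \<in> space M. \<tau> \<omega> < real k * e}" by (auto simp: A_def)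
    then show ?thesis
      using sigma_sets.Compl[OF stopping_time_less_in_augmented_past[OF \<tau>]] by simp
  qed
  then have [measurable]: "A k \<in> sets (completion M)" for k
    using augmented_past_completion by blast
  \<comment> \<open>Rounding up strictly turns \<open>k < idx\<close> into
    \<open>k * e \<le> \<tau>\<close>, the complement of an event already known at time
    \<open>k * e\<close>.\<close>
  have idx_A: "k < idx \<omega> \<longleftrightarrow> \<omega> \<in> A k" if "k < n" "\<omega> \<in> space M" for k \<omega>
  proof -
    have \<tau>0: "0 \<le> \<tau> \<omega>" using \<tau> that(2) by (simp add: stopping_times_upto_def)
    have "k < idx \<omega> \<longleftrightarrow> k \<le> nat \<lfloor>real n * \<tau> \<omega> / s\<rfloor>" using that(1) by (auto simp: idx_def)
    also have "\<dots> \<longleftrightarrow> int k \<le> \<lfloor>real n * \<tau> \<omega> / s\<rfloor>" using \<tau>0 s by (auto simp: le_nat_iff)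
    also have "\<dots> \<longleftrightarrow> real k \<le> real n * \<tau> \<omega> / s" by (simp add: le_floor_iff)
    also have "\<dots> \<longleftrightarrow> real k * e \<le> \<tau> \<omega>" using s n by (simp add: e_def field_simps)
    finally show ?thesis using that(2) by (auto simp: A_def)
  qed
  \<comment> \<open>The process \<open>U\<close> along the grid, frozen at the index
    \<open>idx\<close>.\<close>
  define Z where "Z k \<omega> = U (e * min k (idx \<omega>)) (X (e * min k (idx \<omega>)) \<omega>)" for k \<omega>
  have X_C[measurable]: "X u \<in> borel_measurable (completion M)" for u
    by (intro measurable_completion) measurable
  have Z_0: "Z 0 \<omega> = U 0 0" if "\<omega> \<in> space M" for \<omega>
    using X_0[OF that] by (simp add: Z_def)
  have Z_Suc: "Z (Suc k) \<omega> = (if \<omega> \<in> A k then U (real k * e + e) (X (real k * e + e) \<omega>) else Z k \<omega>)"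
    if "k < n" "\<omega> \<in> space M" for k \<omega>
  proof (cases "\<omega> \<in> A k")
    case True
    then have "min (Suc k) (idx \<omega>) = Suc k" using idx_A[OF that] by simp
    then show ?thesis using True by (simp add: Z_def algebra_simps)
  next
    case False
    then have "min (Suc k) (idx \<omega>) = idx \<omega>" "min k (idx \<omega>) = idx \<omega>" using idx_A[OF that] by auto
    then show ?thesis using False by (simp add: Z_def)
  qed
  have Z_A: "Z k \<omega> = U (real k * e) (X (real k * e) \<omega>)" if "k < n" "\<omega> \<in> A k" for k \<omega>
  proof -
    have "\<omega> \<in> space M" using that(2) by (simp add: A_def)
    then have "min k (idx \<omega>) = k" using idx_A[OF that(1)] that(2) by auto
    then show ?thesis by (simp add: Z_def mult.commute)
  qed
  have Z_meas: "Z k \<in> borel_measurable (completion M)" if "k \<le> n" for k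
    using that
  proof (induction k)
    case 0
    have "Z 0 \<in> borel_measurable (completion M) \<longleftrightarrow> (\<lambda>_. U 0 0) \<in> borel_measurable (completion M)"
      by (intro measurable_cong) (simp add: Z_0)
    then show ?case by simp
  next
    case (Suc k)
    then have [measurable]: "Z k \<in> borel_measurable (completion M)" by simp
    have "(\<lambda>\<omega>. if \<omega> \<in> A k then U (real k * e + e) (X (real k * e + e) \<omega>) else Z k \<omega>)
        \<in> borel_measurable (completion M)"
      by measurable
    moreover have "Z (Suc k) \<in> borel_measurable (completion M) \<longleftrightarrow>
      (\<lambda>\<omega>. if \<omega> \<in> A k then U (real k * e + e) (X (real k * e + e) \<omega>) else Z k \<omega>) \<in> borel_measurable (completion M)"
      using Suc.prems by (intro measurable_cong Z_Suc) auto
    ultimately show ?case by simp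
  qed
  \<comment> \<open>Supermartingale induction: on \<open>A k\<close> the process makes one more
    step, which \<open>integral_step_le\<close> controls; off \<open>A k\<close> it is already
    frozen.\<close>
  have Z_le: "(\<integral>\<omega>. Z k \<omega> \<partial>completion M) \<le> U 0 0"
    if step: "\<And>u e x. 0 \<le> u \<Longrightarrow> 0 < e \<Longrightarrow> u + e \<le> s \<Longrightarrow> (\<integral>\<omega>. U (u + e) (x + X e \<omega>) \<partial>M) \<le> U u x"
      and "k \<le> n" for k
    using that(2)
  proof (induction k)
    case 0
    have "(\<integral>\<omega>. Z 0 \<omega> \<partial>completion M) = (\<integral>\<omega>. U 0 0 \<partial>completion M)"
      by (intro Bochner_Integration.integral_cong refl) (simp add: Z_0)
    then show ?case using C.prob_space by simp
  next
    case (Suc k)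
    then have k: "k < n" by simp
    note Z_meas[OF less_imp_le[OF k], measurable]
    let ?q = "real k * e"
    have iZ: "integrable (completion M) (\<lambda>\<omega>. indicator (- A k) \<omega> * Z k \<omega>)"
    proof (rule C.integrable_const_bound[where B=B])
      show "AE \<omega> in completion M. norm (indicator (- A k) \<omega> * Z k \<omega>) \<le> B"
        using U_bd order_trans[OF abs_ge_zero U_bd] by (auto simp: Z_def indicator_def)
      have "(\<lambda>\<omega>. if \<omega> \<in> A k then 0 else Z k \<omega>) \<in> borel_measurable (completion M)" by measurable
      moreover have "(\<lambda>\<omega>. indicator (- A k) \<omega> * Z k \<omega>) = (\<lambda>\<omega>. if \<omega> \<in> A k then 0 else Z k \<omega>)"
        by (auto simp: indicator_def)
      ultimately show "(\<lambda>\<omega>. indicator (- A k) \<omega> * Z k \<omega>) \<in> borel_measurable (completion M)" by simp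
    qed
    have iU: "integrable (completion M) (\<lambda>\<omega>. indicator (A k) \<omega> * U u (X v \<omega>))" for u v
      using U_bd order_trans[OF abs_ge_zero U_bd]
      by (intro C.integrable_const_bound[where B=B]) (auto simp: indicator_def)
    have "(\<integral>\<omega>. Z (Suc k) \<omega> \<partial>completion M)
       = (\<integral>\<omega>. indicator (A k) \<omega> * U (?q + e) (X (?q + e) \<omega>) + indicator (- A k) \<omega> * Z k \<omega> \<partial>completion M)"
      by (intro Bochner_Integration.integral_cong refl) (auto simp: Z_Suc[OF k] indicator_def)
    also have "\<dots> = (\<integral>\<omega>. indicator (A k) \<omega> * U (?q + e) (X (?q + e) \<omega>) \<partial>completion M)
        + (\<integral>\<omega>. indicator (- A k) \<omega> * Z k \<omega> \<partial>completion M)"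
      by (rule Bochner_Integration.integral_add[OF iU iZ])
    also have "(\<integral>\<omega>. indicator (A k) \<omega> * U (?q + e) (X (?q + e) \<omega>) \<partial>completion M)
       \<le> (\<integral>\<omega>. indicator (A k) \<omega> * U ?q (X ?q \<omega>) \<partial>completion M)"
    proof (rule integral_step_le[OF _ _ U U U_bd U_bd _ A])
      have "real (Suc k) * e \<le> real n * e" using k e by (intro mult_right_mono) auto
      also have "\<dots> = s" using n by (simp add: e_def)
      finally have "?q + e \<le> s" by (simp add: algebra_simps)
      then show "(\<integral>\<omega>. U (?q + e) (x + X e \<omega>) \<partial>M) \<le> U ?q x" for x
        using e by (intro step) auto
    qed (use e in auto)
    also have "(\<integral>\<omega>. indicator (A k) \<omega> * U ?q (X ?q \<omega>) \<partial>completion M)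
        + (\<integral>\<omega>. indicator (- A k) \<omega> * Z k \<omega> \<partial>completion M)
      = (\<integral>\<omega>. indicator (A k) \<omega> * U ?q (X ?q \<omega>) + indicator (- A k) \<omega> * Z k \<omega> \<partial>completion M)"
      by (rule Bochner_Integration.integral_add[OF iU iZ, symmetric])
    also have "\<dots> = (\<integral>\<omega>. Z k \<omega> \<partial>completion M)"
      by (intro Bochner_Integration.integral_cong refl) (auto simp: Z_A[OF k] indicator_def)
    also have "\<dots> \<le> U 0 0" using Suc by simp
    finally show ?case by simp
  qed
  have Z_n: "Z n = (\<lambda>\<omega>. U (s / n * idx \<omega>) (X (s / n * idx \<omega>) \<omega>))"
    by (intro ext) (simp add: Z_def e_def idx_def)
  show "(\<lambda>\<omega>. U (s / n * idx \<omega>) (X (s / n * idx \<omega>) \<omega>)) \<in> borel_measurable (completion M)"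
    using Z_meas[of n] Z_n by simp
  show "(\<integral>\<omega>. U (s / n * idx \<omega>) (X (s / n * idx \<omega>) \<omega>) \<partial>completion M) \<le> U 0 0"
    if "\<And>u e x. 0 \<le> u \<Longrightarrow> 0 < e \<Longrightarrow> u + e \<le> s \<Longrightarrow> (\<integral>\<omega>. U (u + e) (x + X e \<omega>) \<partial>M) \<le> U u x"
    using Z_le[OF that, of n] Z_n by simp
qed

text \<open>On each grid the mean of \<open>f\<close> is at most that of \<open>U\<close>, hence at
  most \<open>U 0 0\<close>. Only \<open>f\<close> is passed to the limit, so continuity is asked of
  \<open>f\<close> while \<open>U\<close> enters through grid times alone.\<close>

lemma stopped_payoff_le:
  fixes U f :: "real \<Rightarrow> real \<Rightarrow> real"
  assumes s: "0 < s" and \<tau>: "\<tau> \<in> stopping_times_upto M X s"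
    and U[measurable]: "\<And>u. U u \<in> borel_measurable borel" and U_bd: "\<And>u x. \<bar>U u x\<bar> \<le> B"
    and step: "\<And>u e x. 0 \<le> u \<Longrightarrow> 0 < e \<Longrightarrow> u + e \<le> s \<Longrightarrow> (\<integral>\<omega>. U (u + e) (x + X e \<omega>) \<partial>M) \<le> U u x"
    and f: "continuous_on UNIV (\<lambda>p. f (fst p) (snd p))" and f_bd: "\<And>u x. \<bar>f u x\<bar> \<le> B"
    and f_le: "\<And>u x. 0 \<le> u \<Longrightarrow> u \<le> s \<Longrightarrow> f u x \<le> U u x"
  shows "(\<integral>\<omega>. f (\<tau> \<omega>) (X (\<tau> \<omega>) \<omega>) \<partial>completion M) \<le> U 0 0"
proof -
  interpret C: prob_space "completion M" by (rule prob_space_completion)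
  define \<theta> where "\<theta> n \<omega> = s / real (Suc n) * real (min (Suc n) (Suc (nat \<lfloor>real (Suc n) * \<tau> \<omega> / s\<rfloor>)))" for n \<omega>
  have f_meas: "f u \<in> borel_measurable borel" for u
  proof (rule borel_measurable_continuous_onI)
    show "continuous_on UNIV (f u)"
      using continuous_on_compose2[OF f continuous_on_Pair[OF continuous_on_const[of UNIV u] continuous_on_id]]
      by simp
  qed
  have fm: "(\<lambda>\<omega>. f (\<theta> n \<omega>) (X (\<theta> n \<omega>) \<omega>)) \<in> borel_measurable (completion M)" for n
    unfolding \<theta>_def by (rule grid_stopping_le(1)[OF s \<tau> f_meas f_bd]) simp
  have Um: "(\<lambda>\<omega>. U (\<theta> n \<omega>) (X (\<theta> n \<omega>) \<omega>)) \<in> borel_measurable (completion M)" for n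
    unfolding \<theta>_def by (rule grid_stopping_le(1)[OF s \<tau> U U_bd]) simp
  \<comment> \<open>The grid times approach \<open>\<tau>\<close> from the right, so right
    continuity of the paths yields convergence of \<open>X\<close>.\<close>
  have \<theta>: "\<tau> \<omega> \<le> \<theta> n \<omega>" "\<theta> n \<omega> \<le> \<tau> \<omega> + s / real (Suc n)" "0 \<le> \<theta> n \<omega>" "\<theta> n \<omega> \<le> s"
    if \<omega>: "\<omega> \<in> space M" for n \<omega>
  proof -
    have \<tau>0: "0 \<le> \<tau> \<omega>" "\<tau> \<omega> \<le> s" using \<tau> \<omega> by (auto simp: stopping_times_upto_def)
    define N where "N = real (Suc n)"
    have N: "0 < N" by (simp add: N_def)
    define m where "m = real_of_int \<lfloor>N * \<tau> \<omega> / s\<rfloor>"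
    have m: "m \<le> N * \<tau> \<omega> / s" "N * \<tau> \<omega> / s < m + 1" unfolding m_def by linarith+
    have eq: "\<theta> n \<omega> = s / N * min N (m + 1)"
    proof -
      have "0 \<le> \<lfloor>N * \<tau> \<omega> / s\<rfloor>" using \<tau>0 s N by simp
      then have "real (Suc (nat \<lfloor>real (Suc n) * \<tau> \<omega> / s\<rfloor>)) = m + 1"
        by (simp add: m_def N_def)
      then show ?thesis unfolding \<theta>_def of_nat_min N_def by (simp add: add.commute)
    qed
    have "s / N * N = s" using N by simp
    have 1: "s / N * (m + 1) \<le> \<tau> \<omega> + s / N"
      using mult_left_mono[OF m(1), of "s / N"] s N by (simp add: field_simps)
    have 2: "\<tau> \<omega> \<le> s / N * (m + 1)"
      using mult_left_mono[OF less_imp_le[OF m(2)], of "s / N"] s N by (simp add: field_simps)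
    have "0 \<le> s / N" using s N by simp
    then have e2: "\<theta> n \<omega> = min s (s / N * (m + 1))"
      unfolding eq using \<open>s / N * N = s\<close> by (simp add: min_mult_distrib_left)
    show "\<tau> \<omega> \<le> \<theta> n \<omega>" "\<theta> n \<omega> \<le> \<tau> \<omega> + s / real (Suc n)" "0 \<le> \<theta> n \<omega>" "\<theta> n \<omega> \<le> s"
      unfolding e2 using 1 2 \<tau>0 s by (auto simp: N_def)
  qed
  have conv: "(\<lambda>n. f (\<theta> n \<omega>) (X (\<theta> n \<omega>) \<omega>)) \<longlonglongrightarrow> f (\<tau> \<omega>) (X (\<tau> \<omega>) \<omega>)" if \<omega>: "\<omega> \<in> space M" for \<omega>
  proof -
    have "0 \<le> \<tau> \<omega>" using \<tau> \<omega> by (auto simp: stopping_times_upto_def)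
    have "(\<lambda>n. s * (1 / real (Suc n))) \<longlonglongrightarrow> s * 0"
      by (intro tendsto_intros LIMSEQ_Suc[OF lim_1_over_n])
    then have up: "(\<lambda>n. \<tau> \<omega> + s / real (Suc n)) \<longlonglongrightarrow> \<tau> \<omega>"
      using tendsto_add[OF tendsto_const[of "\<tau> \<omega>"]] by fastforce
    have \<theta>_lim: "(\<lambda>n. \<theta> n \<omega>) \<longlonglongrightarrow> \<tau> \<omega>"
      by (rule tendsto_sandwich[OF _ _ tendsto_const up]) (use \<theta>[OF \<omega>] in auto)
    have "continuous (at (\<tau> \<omega>) within {\<tau> \<omega>..}) (\<lambda>t. X t \<omega>)"
      unfolding at_within_Ici_at_right by (rule X_right_continuous[OF \<omega> \<open>0 \<le> \<tau> \<omega>\<close>])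
    then have X_lim: "(\<lambda>n. X (\<theta> n \<omega>) \<omega>) \<longlonglongrightarrow> X (\<tau> \<omega>) \<omega>"
      by (rule continuous_within_tendsto_compose') (use \<theta>(1)[OF \<omega>] \<theta>_lim in auto)
    have "isCont (\<lambda>p. f (fst p) (snd p)) (\<tau> \<omega>, X (\<tau> \<omega>) \<omega>)"
      using f by (simp add: continuous_on_eq_continuous_at)
    from isCont_tendsto_compose[OF this tendsto_Pair[OF \<theta>_lim X_lim]] show ?thesis by simp
  qed
  have "(\<lambda>n. \<integral>\<omega>. f (\<theta> n \<omega>) (X (\<theta> n \<omega>) \<omega>) \<partial>completion M) \<longlonglongrightarrow> (\<integral>\<omega>. f (\<tau> \<omega>) (X (\<tau> \<omega>) \<omega>) \<partial>completion M)"
  proof (rule integral_dominated_convergence[where w="\<lambda>_. B"])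
    show "(\<lambda>\<omega>. f (\<tau> \<omega>) (X (\<tau> \<omega>) \<omega>)) \<in> borel_measurable (completion M)"
      by (rule borel_measurable_LIMSEQ_real[OF conv fm]) simp
    show "AE \<omega> in completion M. (\<lambda>n. f (\<theta> n \<omega>) (X (\<theta> n \<omega>) \<omega>)) \<longlonglongrightarrow> f (\<tau> \<omega>) (X (\<tau> \<omega>) \<omega>)"
      using conv by (intro AE_I2) simp
  qed (use fm f_bd in auto)
  moreover have "(\<integral>\<omega>. f (\<theta> n \<omega>) (X (\<theta> n \<omega>) \<omega>) \<partial>completion M) \<le> U 0 0" for n
  proof -
    have "(\<integral>\<omega>. f (\<theta> n \<omega>) (X (\<theta> n \<omega>) \<omega>) \<partial>completion M) \<le> (\<integral>\<omega>. U (\<theta> n \<omega>) (X (\<theta> n \<omega>) \<omega>) \<partial>completion M)"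
    proof (rule integral_mono)
      show "integrable (completion M) (\<lambda>\<omega>. f (\<theta> n \<omega>) (X (\<theta> n \<omega>) \<omega>))"
        using fm f_bd by (intro C.integrable_const_bound[where B=B]) auto
      show "integrable (completion M) (\<lambda>\<omega>. U (\<theta> n \<omega>) (X (\<theta> n \<omega>) \<omega>))"
        using Um U_bd by (intro C.integrable_const_bound[where B=B]) auto
    qed (use \<theta> f_le in simp)
    also have "\<dots> \<le> U 0 0"
      unfolding \<theta>_def by (rule grid_stopping_le(2)[OF s \<tau> U U_bd _ step]) simp_all
    finally show ?thesis .
  qed
  ultimately show ?thesis by (intro LIMSEQ_le_const2) auto
qed

end

section \<open>The supersolution\<close>

context finite_variation_levy
begin

definition down_rate :: real where "down_rate = (\<integral>y. max 0 (1 - exp y) \<partial>\<nu>)"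

lemma down_rate_nonneg: "0 \<le> down_rate"
  unfolding down_rate_def by (rule integral_nonneg_AE) simp

text \<open>Finite variation excludes the infinite integral over upward jumps, so negative jumps
  exist; a vanishing \<open>down_rate\<close> would make \<open>\<nu>\<close> null on the negative
  half-line.\<close>

lemma down_rate_pos:
  assumes "emeasure \<nu> {..<0} > 0 \<or> (\<integral>\<^sup>+ x. indicator {0<..} x * ennreal (min x 1) \<partial>\<nu>) = \<infinity>"
  shows "0 < down_rate"
proof -
  have "(\<integral>\<^sup>+ x. indicator {0<..} x * ennreal (min x 1) \<partial>\<nu>) \<le> (\<integral>\<^sup>+ x. ennreal (min 1 \<bar>x\<bar>) \<partial>\<nu>)"
    by (intro nn_integral_mono) (auto simp: indicator_def min.commute)
  also have "\<dots> < \<infinity>"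
    using integrable_min_1_abs by (subst nn_integral_eq_integral) auto
  finally have pos: "emeasure \<nu> {..<0} > 0" using assms by auto
  have "down_rate \<noteq> 0"
  proof
    assume "down_rate = 0"
    then have "AE y in \<nu>. max 0 (1 - exp y) = 0"
      unfolding down_rate_def using integrable_payoff by (subst (asm) integral_nonneg_eq_0_iff_AE) auto
    then have "AE y in \<nu>. y \<notin> {..<0}" by eventually_elim (auto simp: max_def split: if_splits)
    then have "{y \<in> space \<nu>. \<not> y \<notin> {..<0}} \<in> null_sets \<nu>" by (subst (asm) AE_iff_null) auto
    moreover have "{y \<in> space \<nu>. \<not> y \<notin> {..<0}} = {..<0}"
      using sets_eq_imp_space_eq[OF sets_nu] by auto
    ultimately show False using pos by (auto simp: null_sets_def)
  qed
  with down_rate_nonneg show ?thesis by simp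
qed

text \<open>Splitting \<open>exp y - 1\<close> into positive and negative parts translates
  positivity of \<open>d_+\<close> into \<open>down_rate < r - \<delta> + drift\<close>.\<close>

lemma drift_eq: "drift = down_rate - (\<integral>y. max 0 (exp y - 1) \<partial>\<nu>)"
proof -
  have "integrable \<nu> (\<lambda>y. max 0 (exp y - 1))"
    using integrable_exp_minus_1 by (intro integrable_max) auto
  then have "(\<integral>y. max 0 (1 - exp y) - max 0 (exp y - 1) \<partial>\<nu>) = down_rate - (\<integral>y. max 0 (exp y - 1) \<partial>\<nu>)"
    unfolding down_rate_def by (rule Bochner_Integration.integral_diff[OF integrable_payoff])
  moreover have "(\<lambda>y::real. max 0 (1 - exp y) - max 0 (exp y - 1)) = (\<lambda>y. - (exp y - 1))"
    by (auto simp: max_def)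
  ultimately show ?thesis by (simp add: drift_def del: minus_diff_eq)
qed

text \<open>The supersolution \<open>max (K - S) (K l \<theta>)\<close>, where \<open>\<theta>\<close> is the time to maturity: it equals the
  put payoff exactly when \<open>S \<le> K (1 - l \<theta>)\<close>. At the kink \<open>S = K (1 - l \<theta>)\<close> the drift lifts the
  price over the moving kink and only the downward jumps contribute; above the kink one uses
  monotonicity in \<open>S\<close>, below it convexity between \<open>0\<close> and the kink.\<close>

lemma supersolution_step:
  assumes K: "0 < K" and l: "0 < l" and d: "0 < q + drift"
    and kink: "l \<le> (1 - l * s) * (q + drift)" and slack: "(1 + (q + drift) * s) * down_rate \<le> l"
    and u: "0 \<le> \<theta>" "0 < e" "\<theta> + e \<le> s" and S: "0 \<le> S"
  shows "(\<integral>\<omega>. max (K - S * exp (q * e + X e \<omega>)) (K * l * \<theta>) \<partial>M) \<le> max (K - S) (K * l * (\<theta> + e))"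
proof -
  define d where "d = q + drift"
  define V where "V z = max (K - z) (K * l * \<theta>)" for z
  \<comment> \<open>\<open>K * \<kappa>\<close> is the kink of the supersolution at the start of the
    period, while \<open>V\<close> is the supersolution at its end.\<close>
  define \<kappa> where "\<kappa> = 1 - l * (\<theta> + e)"
  have d0: "0 < d" using assms by (simp add: d_def)
  have "0 < (1 - l * s) * d" using kink l by (simp add: d_def)
  then have ls: "0 < 1 - l * s" using d0 by (simp add: zero_less_mult_iff)
  have l\<theta>: "l * (\<theta> + e) \<le> l * s" using u l by (intro mult_left_mono) auto
  moreover have "0 \<le> l * (\<theta> + e)" using l u by simp
  ultimately have \<kappa>: "0 < \<kappa>" "\<kappa> \<le> 1" "1 - l * s \<le> \<kappa>" using ls unfolding \<kappa>_def by linarith+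
  have "(1 - l * s) * d \<le> \<kappa> * d" using \<kappa> d0 by (intro mult_right_mono) auto
  then have l\<kappa>: "l \<le> \<kappa> * d" using kink by (simp add: d_def)
  have l\<theta>1: "l * \<theta> \<le> 1"
    using \<kappa>(1) l u mult_left_mono[of \<theta> "\<theta> + e" l] unfolding \<kappa>_def by linarith
  have Kl: "0 \<le> K * l * \<theta>" "K * l * \<theta> \<le> K"
    using K l u l\<theta>1 mult_left_mono[of "l * \<theta>" 1 K] by (auto simp: mult.assoc)
  have V_bd: "\<bar>V z\<bar> \<le> K" if "0 \<le> z" for z using that Kl by (auto simp: V_def)
  have V_int: "integrable M (\<lambda>\<omega>. V (z * exp (q * e + X e \<omega>)))" if "0 \<le> z" for z
    using V_bd that unfolding V_def by (intro integrable_const_bound[where B=K]) auto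
  \<comment> \<open>From \<open>K - K * \<kappa> = K * l * (\<theta> + e)\<close> and
    \<open>l \<le> \<kappa> * d\<close>, the value above the floor \<open>K * l * \<theta>\<close>
    is at most \<open>K * \<kappa>\<close> times a put payoff with strike \<open>1 + d * e\<close>.
    Its mean is at most \<open>l * e\<close> by \<open>integral_payoff_le\<close> and
    \<open>slack\<close>.\<close>
  have at_kink: "(\<integral>\<omega>. V (K * \<kappa> * exp (q * e + X e \<omega>)) \<partial>M) \<le> K * l * (\<theta> + e)"
  proof -
    have int: "integrable M (\<lambda>\<omega>. max 0 (1 + d * e - exp (q * e + X e \<omega>)))"
      using d0 u by (intro integrable_const_bound[where B="1 + d * e"]) auto
    have "(\<integral>\<omega>. V (K * \<kappa> * exp (q * e + X e \<omega>)) \<partial>M)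
       \<le> (\<integral>\<omega>. K * l * \<theta> + K * \<kappa> * max 0 (1 + d * e - exp (q * e + X e \<omega>)) \<partial>M)"
    proof (rule integral_mono)
      show "integrable M (\<lambda>\<omega>. V (K * \<kappa> * exp (q * e + X e \<omega>)))" using K \<kappa> by (intro V_int) simp
      show "integrable M (\<lambda>\<omega>. K * l * \<theta> + K * \<kappa> * max 0 (1 + d * e - exp (q * e + X e \<omega>)))"
        using int by simp
      fix \<omega>
      define y where "y = exp (q * e + X e \<omega>)"
      have "K * (l * e) \<le> K * (\<kappa> * d * e)" using l\<kappa> K u by (intro mult_left_mono mult_right_mono) auto
      then have "K - K * \<kappa> * y \<le> K * l * \<theta> + K * \<kappa> * (1 + d * e - y)"
        by (simp add: \<kappa>_def algebra_simps)
      also have "\<dots> \<le> K * l * \<theta> + K * \<kappa> * max 0 (1 + d * e - y)"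
        using K \<kappa> by (intro add_left_mono mult_left_mono) auto
      finally show "V (K * \<kappa> * exp (q * e + X e \<omega>)) \<le> K * l * \<theta> + K * \<kappa> * max 0 (1 + d * e - exp (q * e + X e \<omega>))"
        unfolding y_def[symmetric] V_def using K \<kappa> by auto
    qed
    also have "\<dots> = K * l * \<theta> + K * \<kappa> * (\<integral>\<omega>. max 0 (1 + d * e - exp (q * e + X e \<omega>)) \<partial>M)"
      using int by (subst Bochner_Integration.integral_add) (auto simp: prob_space)
    also have "\<dots> \<le> K * l * \<theta> + K * 1 * ((1 + d * e) * (e * down_rate))"
    proof (intro add_left_mono mult_mono)
      show "(\<integral>\<omega>. max 0 (1 + d * e - exp (q * e + X e \<omega>)) \<partial>M) \<le> (1 + d * e) * (e * down_rate)"
        unfolding down_rate_def using u d0 by (intro integral_payoff_le) (auto simp: d_def)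
    qed (use K \<kappa> in auto)
    also have "(1 + d * e) * (e * down_rate) \<le> l * e"
    proof -
      have "(1 + d * e) * down_rate \<le> (1 + d * s) * down_rate"
        using u d0 down_rate_nonneg by (intro mult_right_mono) auto
      also have "\<dots> \<le> l" using slack by (simp add: d_def)
      finally have "(1 + d * e) * down_rate * e \<le> l * e" using u by (intro mult_right_mono) auto
      then show ?thesis by (simp add: algebra_simps)
    qed
    finally show ?thesis using K by (simp add: algebra_simps)
  qed
  have "(\<integral>\<omega>. V (S * exp (q * e + X e \<omega>)) \<partial>M) \<le> max (K - S) (K * l * (\<theta> + e))"
  proof (cases "K * \<kappa> \<le> S")
    case True
    have "(\<integral>\<omega>. V (S * exp (q * e + X e \<omega>)) \<partial>M) \<le> (\<integral>\<omega>. V (K * \<kappa> * exp (q * e + X e \<omega>)) \<partial>M)"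
    proof (rule integral_mono)
      fix \<omega>
      have "K * \<kappa> * exp (q * e + X e \<omega>) \<le> S * exp (q * e + X e \<omega>)"
        using True by (intro mult_right_mono) auto
      then show "V (S * exp (q * e + X e \<omega>)) \<le> V (K * \<kappa> * exp (q * e + X e \<omega>))"
        unfolding V_def by (intro max.mono) auto
    qed (use K \<kappa> S in \<open>auto intro!: V_int\<close>)
    with at_kink show ?thesis by linarith
  next
    case False
    \<comment> \<open>Writes \<open>S\<close> as a convex combination of 0 and the kink;
      \<open>V\<close> is convex with \<open>V 0 = K\<close>.\<close>
    define \<alpha> where "\<alpha> = S / (K * \<kappa>)"
    have \<alpha>: "0 \<le> \<alpha>" "\<alpha> \<le> 1" "\<alpha> * (K * \<kappa>) = S" using False S K \<kappa> by (auto simp: \<alpha>_def)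
    have "(\<integral>\<omega>. V (S * exp (q * e + X e \<omega>)) \<partial>M)
       \<le> (\<integral>\<omega>. \<alpha> * V (K * \<kappa> * exp (q * e + X e \<omega>)) + (1 - \<alpha>) * K \<partial>M)"
    proof (rule integral_mono)
      show "integrable M (\<lambda>\<omega>. V (S * exp (q * e + X e \<omega>)))" using S by (intro V_int)
      show "integrable M (\<lambda>\<omega>. \<alpha> * V (K * \<kappa> * exp (q * e + X e \<omega>)) + (1 - \<alpha>) * K)"
        using V_int[of "K * \<kappa>"] K \<kappa> by simp
      fix \<omega>
      define z where "z = K * \<kappa> * exp (q * e + X e \<omega>)"
      have eq: "S * exp (q * e + X e \<omega>) = \<alpha> * z" using \<alpha>(3) by (simp add: z_def mult.assoc[symmetric])
      have "\<alpha> * (K - z) \<le> \<alpha> * V z" "\<alpha> * (K * l * \<theta>) \<le> \<alpha> * V z"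
        using \<alpha> by (auto simp: V_def intro!: mult_left_mono)
      moreover have "(1 - \<alpha>) * (K * l * \<theta>) \<le> (1 - \<alpha>) * K"
        using \<alpha> Kl by (intro mult_left_mono) auto
      ultimately have "K - \<alpha> * z \<le> \<alpha> * V z + (1 - \<alpha>) * K" "K * l * \<theta> \<le> \<alpha> * V z + (1 - \<alpha>) * K"
        by (simp_all add: algebra_simps)
      then show "V (S * exp (q * e + X e \<omega>)) \<le> \<alpha> * V (K * \<kappa> * exp (q * e + X e \<omega>)) + (1 - \<alpha>) * K"
        unfolding eq z_def[symmetric] by (simp add: V_def)
    qed
    also have "\<dots> = \<alpha> * (\<integral>\<omega>. V (K * \<kappa> * exp (q * e + X e \<omega>)) \<partial>M) + (1 - \<alpha>) * K"
      using V_int[of "K * \<kappa>"] K \<kappa> by (subst Bochner_Integration.integral_add) (auto simp: prob_space)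
    also have "\<dots> \<le> \<alpha> * (K * l * (\<theta> + e)) + (1 - \<alpha>) * K"
      using at_kink \<alpha> by (intro add_right_mono mult_left_mono) auto
    \<comment> \<open>Both branches agree at the kink, so the interpolation lies on the line
      \<open>K - S\<close>.\<close>
    also have "\<dots> = K - \<alpha> * (K * \<kappa>)" by (simp add: \<kappa>_def algebra_simps)
    also have "\<dots> = K - S" using \<alpha>(3) by simp
    finally show ?thesis by simp
  qed
  then show ?thesis by (simp add: V_def)
qed

text \<open>Optional stopping for the supersolution along the price. The bound on \<open>x\<close>
  puts the start at or below the kink, where the supersolution equals \<open>K - x\<close>.\<close>

lemma put_payoff_le_supersolution:
  assumes K: "0 < K" and r: "0 \<le> r" and l: "0 < l" and s: "0 < s" and d: "0 < r - \<delta> + drift"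
    and kink: "l \<le> (1 - l * s) * (r - \<delta> + drift)" and slack: "(1 + (r - \<delta> + drift) * s) * down_rate \<le> l"
    and x: "0 \<le> x" "x \<le> K * (1 - l * s)" and \<tau>: "\<tau> \<in> stopping_times_upto M X s"
  shows "(\<integral>\<omega>. exp (- r * \<tau> \<omega>) * max 0 (K - x * exp ((r - \<delta>) * \<tau> \<omega> + X (\<tau> \<omega>) \<omega>)) \<partial>completion M) \<le> K - x"
proof -
  \<comment> \<open>Clamping to \<open>[0, s]\<close> makes \<open>U\<close> bounded for every real
    time, as \<open>stopped_payoff_le\<close> demands; \<open>max 0 u\<close> in \<open>f\<close>
    does the same for the discount.\<close>
  define \<theta> where "\<theta> u = max 0 (min s (s - u))" for u
  define U where "U u y = max (K - x * exp ((r - \<delta>) * u + y)) (K * l * \<theta> u)" for u y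
  define f where "f u y = exp (- r * max 0 u) * max 0 (K - x * exp ((r - \<delta>) * u + y))" for u y
  have "0 < (1 - l * s) * (r - \<delta> + drift)" using kink l by linarith
  then have ls: "l * s < 1" using d by (simp add: zero_less_mult_iff)
  have \<theta>0: "0 \<le> \<theta> u" for u by (simp add: \<theta>_def)
  have \<theta>K: "K * l * \<theta> u \<le> K" for u
  proof -
    have "l * \<theta> u \<le> l * s" using l s by (intro mult_left_mono) (auto simp: \<theta>_def)
    with ls have "l * \<theta> u \<le> 1" by simp
    with K show ?thesis using mult_left_mono[of "l * \<theta> u" 1 K] by (simp add: mult.assoc)
  qed
  have "(\<integral>\<omega>. exp (- r * \<tau> \<omega>) * max 0 (K - x * exp ((r - \<delta>) * \<tau> \<omega> + X (\<tau> \<omega>) \<omega>)) \<partial>completion M)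
      = (\<integral>\<omega>. f (\<tau> \<omega>) (X (\<tau> \<omega>) \<omega>) \<partial>completion M)"
    using \<tau> by (intro Bochner_Integration.integral_cong refl) (auto simp: f_def stopping_times_upto_def)
  also have "\<dots> \<le> U 0 0"
  proof (rule stopped_payoff_le[OF s \<tau>, where B=K and U=U and f=f])
    show "U u \<in> borel_measurable borel" for u unfolding U_def by measurable
    have pay: "0 \<le> max 0 (K - x * exp z)" "max 0 (K - x * exp z) \<le> K" for z
      using x K by auto
    show "\<bar>U u y\<bar> \<le> K" for u y
      using pay(2)[of "(r - \<delta>) * u + y"] \<theta>0[of u] \<theta>K[of u] K l unfolding U_def by (auto simp: abs_le_iff le_max_iff_disj)
    have disc: "exp (- r * max 0 u) \<le> 1" for u using r by simp
    have f_pay: "0 \<le> f u y" "f u y \<le> max 0 (K - x * exp ((r - \<delta>) * u + y))" for u y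
      unfolding f_def using mult_right_mono[OF disc pay(1)] by auto
    show "\<bar>f u y\<bar> \<le> K" for u y
      using f_pay[of u y] pay(2)[of "(r - \<delta>) * u + y"] by linarith
    show "f u y \<le> U u y" if "0 \<le> u" "u \<le> s" for u y
    proof -
      have "0 \<le> K * l * \<theta> u" using K l \<theta>0 by simp
      then show ?thesis using f_pay(2)[of u y] by (auto simp: U_def)
    qed
    show "continuous_on UNIV (\<lambda>p. f (fst p) (snd p))"
      unfolding f_def by (intro continuous_intros)
    show "(\<integral>\<omega>. U (u + e) (y + X e \<omega>) \<partial>M) \<le> U u y" if u: "0 \<le> u" "0 < e" "u + e \<le> s" for u e y
    proof -
      have th: "\<theta> (u + e) = s - u - e" "\<theta> u = s - u" using u by (auto simp: \<theta>_def)
      have "(\<integral>\<omega>. max (K - (x * exp ((r - \<delta>) * u + y)) * exp ((r - \<delta>) * e + X e \<omega>)) (K * l * (s - u - e)) \<partial>M)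
         \<le> max (K - x * exp ((r - \<delta>) * u + y)) (K * l * ((s - u - e) + e))"
        using u x by (intro supersolution_step[OF K l d kink slack]) auto
      moreover have "(x * exp ((r - \<delta>) * u + y)) * exp ((r - \<delta>) * e + z) = x * exp ((r - \<delta>) * (u + e) + (y + z))" for z
        by (simp add: mult.assoc exp_add[symmetric] algebra_simps)
      ultimately show ?thesis unfolding U_def th by simp
    qed
  qed
  also have "U 0 0 = K - x"
    using x s by (simp add: U_def \<theta>_def algebra_simps)
  finally show ?thesis .
qed

end

section \<open>The critical price\<close>

lemma eventually_time_to_maturity:
  fixes T :: real
  assumes "eventually P (at_right 0)"
  shows "eventually (\<lambda>t. P (T - t)) (at_left T)"
proof -
  have "filterlim (\<lambda>t. T - t) (at_right 0) (at_left T)"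
    unfolding filterlim_at
  proof
    show "eventually (\<lambda>t. T - t \<in> {0<..} \<and> T - t \<noteq> 0) (at_left T)"
      by (auto simp: eventually_at_filter)
    have "((\<lambda>t. T - t) \<longlongrightarrow> T - T) (at_left T)" by (intro tendsto_intros)
    then show "((\<lambda>t. T - t) \<longlongrightarrow> 0) (at_left T)" by simp
  qed
  with assms show ?thesis by (rule eventually_compose_filterlim)
qed

lemma (in levy_space) const_stopping_time:
  "0 \<le> c \<Longrightarrow> c \<le> s \<Longrightarrow> (\<lambda>_. c) \<in> stopping_times_upto M X s"
  by (simp add: stopping_times_upto_def stopping_time_const)

section \<open>Bounds on the put price and the limit of the critical price\<close>

context finite_variation_levy
begin

lemma put_price_le:
  assumes "0 < K" "0 \<le> r" "0 < l" "t < T" "0 < r - \<delta> + drift"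
    and "l \<le> (1 - l * (T - t)) * (r - \<delta> + drift)" "(1 + (r - \<delta> + drift) * (T - t)) * down_rate \<le> l"
    and "0 \<le> x" "x \<le> K * (1 - l * (T - t))"
  shows "put_price M X r \<delta> K T t x \<le> K - x"
  unfolding put_price_def
proof (rule cSup_least)
  show "(\<lambda>\<tau>. \<integral>\<omega>. exp (- r * \<tau> \<omega>) * max 0 (K - x * exp ((r - \<delta>) * \<tau> \<omega> + X (\<tau> \<omega>) \<omega>)) \<partial>completion M)
      ` stopping_times_upto M X (T - t) \<noteq> {}"
    using const_stopping_time[of 0 "T - t"] assms by auto
qed (use assms put_payoff_le_supersolution[of K r l "T - t" \<delta> x] in auto)

lemma put_price_ge_european:
  assumes K: "0 \<le> K" and r: "0 \<le> r" and t: "t \<le> T" and x: "0 \<le> x"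
  shows "exp (- r * (T - t)) * (\<integral>\<omega>. max 0 (K - x * exp ((r - \<delta>) * (T - t) + X (T - t) \<omega>)) \<partial>M)
    \<le> put_price M X r \<delta> K T t x"
proof -
  interpret C: prob_space "completion M" by (rule prob_space_completion)
  define P where "P \<tau> = (\<integral>\<omega>. exp (- r * \<tau> \<omega>) * max 0 (K - x * exp ((r - \<delta>) * \<tau> \<omega> + X (\<tau> \<omega>) \<omega>)) \<partial>completion M)" for \<tau>
  \<comment> \<open>Boundedness is what lets the real supremum dominate its members. A payoff that
    is not integrable has integral 0 by convention, which is below \<open>K\<close> too.\<close>
  have "P \<tau> \<le> K" if \<tau>: "\<tau> \<in> stopping_times_upto M X (T - t)" for \<tau>
  proof -
    have le: "exp (- r * \<tau> \<omega>) * max 0 (K - x * exp z) \<le> K" if "\<omega> \<in> space M" for \<omega> z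
    proof -
      have "exp (- r * \<tau> \<omega>) * max 0 (K - x * exp z) \<le> 1 * K"
        using that \<tau> K r x by (intro mult_mono) (auto simp: stopping_times_upto_def)
      then show ?thesis by simp
    qed
    show ?thesis unfolding P_def
    proof (cases "integrable (completion M) (\<lambda>\<omega>. exp (- r * \<tau> \<omega>) * max 0 (K - x * exp ((r - \<delta>) * \<tau> \<omega> + X (\<tau> \<omega>) \<omega>)))")
      case True
      then show "(\<integral>\<omega>. exp (- r * \<tau> \<omega>) * max 0 (K - x * exp ((r - \<delta>) * \<tau> \<omega> + X (\<tau> \<omega>) \<omega>)) \<partial>completion M) \<le> K"
        using le by (intro C.integral_le_const) auto
    qed (simp add: not_integrable_integral_eq K)
  qed
  then have bdd: "bdd_above (P ` stopping_times_upto M X (T - t))" by (intro bdd_aboveI2) auto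
  have "P (\<lambda>_. T - t) = exp (- r * (T - t)) * (\<integral>\<omega>. max 0 (K - x * exp ((r - \<delta>) * (T - t) + X (T - t) \<omega>)) \<partial>M)"
    unfolding P_def by (subst integral_completion) auto
  moreover have "P (\<lambda>_. T - t) \<le> Sup (P ` stopping_times_upto M X (T - t))"
    using t by (intro cSup_upper[OF _ bdd] imageI const_stopping_time) auto
  ultimately show ?thesis by (simp add: put_price_def P_def)
qed

text \<open>The choice of \<open>x\<close> gives \<open>K - x = x * l * (T - t)\<close>, so
  \<open>gain\<close>, scaled by \<open>x\<close>, compares the European put of strike
  \<open>x\<close> with immediate exercise; raising the strike to \<open>K\<close> only
  helps.\<close>

lemma put_price_gt:
  assumes K: "0 < K" and r: "0 \<le> r" and t: "t < T" and l: "0 \<le> l"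
    and gain: "l * (T - t) < exp (- r * (T - t)) * (\<integral>\<omega>. max 0 (1 - exp ((r - \<delta>) * (T - t) + X (T - t) \<omega>)) \<partial>M)"
  defines "x \<equiv> K / (1 + l * (T - t))"
  shows "max 0 (K - x) < put_price M X r \<delta> K T t x"
proof -
  define s where "s = T - t"
  have s: "0 < s" using t by (simp add: s_def)
  have ls: "0 < 1 + l * s" using l s by (simp add: add_pos_nonneg)
  have x0: "0 < x" using K ls by (simp add: x_def s_def)
  have Kx: "K = x * (1 + l * s)" using ls by (simp add: x_def s_def)
  have "max 0 (K - x) = x * (l * s)" using x0 l s by (simp add: Kx algebra_simps)
  also have "\<dots> < x * (exp (- r * s) * (\<integral>\<omega>. max 0 (1 - exp ((r - \<delta>) * s + X s \<omega>)) \<partial>M))"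
    using gain x0 by (simp add: s_def)
  also have "\<dots> = exp (- r * s) * (\<integral>\<omega>. x * max 0 (1 - exp ((r - \<delta>) * s + X s \<omega>)) \<partial>M)"
    by simp
  also have "\<dots> \<le> exp (- r * s) * (\<integral>\<omega>. max 0 (K - x * exp ((r - \<delta>) * s + X s \<omega>)) \<partial>M)"
  proof (intro mult_left_mono integral_mono)
    show "integrable M (\<lambda>\<omega>. x * max 0 (1 - exp ((r - \<delta>) * s + X s \<omega>)))"
      by (intro integrable_mult_right integrable_const_bound[where B=1]) auto
    show "integrable M (\<lambda>\<omega>. max 0 (K - x * exp ((r - \<delta>) * s + X s \<omega>)))"
      using K x0 by (intro integrable_const_bound[where B=K]) auto
    fix \<omega>
    define y where "y = exp ((r - \<delta>) * s + X s \<omega>)"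
    have "x * (1 - y) \<le> K - x * y" using x0 l s by (simp add: Kx algebra_simps)
    then show "x * max 0 (1 - exp ((r - \<delta>) * s + X s \<omega>)) \<le> max 0 (K - x * exp ((r - \<delta>) * s + X s \<omega>))"
      unfolding y_def[symmetric] by (auto simp: max_def)
  qed simp
  also have "\<dots> \<le> put_price M X r \<delta> K T t x"
    unfolding s_def using K r t x0 by (intro put_price_ge_european) auto
  finally show ?thesis .
qed

text \<open>An intermediate rate \<open>l'\<close> between \<open>l\<close> and
  \<open>down_rate\<close> leaves room for the discount factor, which tends to 1.\<close>

lemma eventually_put_price_gt:
  assumes K: "0 < K" and r: "0 \<le> r" and l: "0 \<le> l" "l < down_rate"
  shows "eventually (\<lambda>t. K / (1 + l * (T - t)) \<in> {x. 0 \<le> x \<and> put_price M X r \<delta> K T t x > max 0 (K - x)}) (at_left T)"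
proof -
  obtain l' where l': "l < l'" "l' < down_rate" using dense[OF l(2)] by blast
  have "((\<lambda>s. exp (- r * s) * l') \<longlongrightarrow> exp (- r * 0) * l') (at_right 0)" by (intro tendsto_intros)
  then have "eventually (\<lambda>s. l < exp (- r * s) * l') (at_right 0)"
    by (rule order_tendstoD) (use l' in simp)
  moreover have "eventually (\<lambda>s. l' * s \<le> (\<integral>\<omega>. max 0 (1 - exp ((r - \<delta>) * s + X s \<omega>)) \<partial>M)) (at_right 0)"
    using l'(2) unfolding down_rate_def by (rule eventually_integral_payoff_ge)
  moreover have "eventually (\<lambda>s::real. 0 < s) (at_right 0)" by (rule eventually_at_right_less)
  ultimately have "eventually (\<lambda>s. 0 < s \<and> l * s < exp (- r * s) * (\<integral>\<omega>. max 0 (1 - exp ((r - \<delta>) * s + X s \<omega>)) \<partial>M)) (at_right 0)"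
  proof eventually_elim
    case (elim s)
    have "l * s < exp (- r * s) * l' * s" using elim by (intro mult_strict_right_mono) auto
    also have "\<dots> \<le> exp (- r * s) * (\<integral>\<omega>. max 0 (1 - exp ((r - \<delta>) * s + X s \<omega>)) \<partial>M)"
      unfolding mult.assoc using elim by (intro mult_left_mono) auto
    finally show ?case using elim by simp
  qed
  from eventually_time_to_maturity[OF this, of T] show ?thesis
  proof eventually_elim
    case (elim t)
    then show ?case using put_price_gt[OF K r _ l(1), of t T \<delta>] K l by (auto intro!: divide_nonneg_nonneg)
  qed
qed

text \<open>At time to maturity 0 the kink and slack conditions read
  \<open>l < r - \<delta> + drift\<close> and \<open>down_rate < l\<close>; being strict, they
  persist for small times.\<close>

lemma eventually_put_price_le:
  assumes K: "0 < K" and r: "0 \<le> r" and l: "down_rate < l" "l < r - \<delta> + drift"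
  shows "eventually (\<lambda>t. \<forall>x. 0 \<le> x \<longrightarrow> x \<le> K * (1 - l * (T - t)) \<longrightarrow> put_price M X r \<delta> K T t x \<le> K - x) (at_left T)"
proof -
  let ?d = "r - \<delta> + drift"
  have l0: "0 < l" using l(1) down_rate_nonneg by simp
  have "((\<lambda>s. (1 - l * s) * ?d) \<longlongrightarrow> (1 - l * 0) * ?d) (at_right 0)" by (intro tendsto_intros)
  then have "eventually (\<lambda>s. l < (1 - l * s) * ?d) (at_right 0)"
    by (rule order_tendstoD) (use l in simp)
  moreover have "((\<lambda>s. (1 + ?d * s) * down_rate) \<longlongrightarrow> (1 + ?d * 0) * down_rate) (at_right 0)" by (intro tendsto_intros)
  then have "eventually (\<lambda>s. (1 + ?d * s) * down_rate < l) (at_right 0)"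
    by (rule order_tendstoD) (use l in simp)
  moreover have "eventually (\<lambda>s::real. 0 < s) (at_right 0)" by (rule eventually_at_right_less)
  ultimately have "eventually (\<lambda>s. 0 < s \<and> l < (1 - l * s) * ?d \<and> (1 + ?d * s) * down_rate < l) (at_right 0)"
    by eventually_elim simp
  from eventually_time_to_maturity[OF this, of T] show ?thesis
  proof eventually_elim
    case (elim t)
    then show ?case using l l0 by (intro allI impI put_price_le[OF K r l0]) auto
  qed
qed

lemma eventually_critical_price_bounds:
  assumes K: "0 < K" and r: "0 \<le> r" and l: "0 \<le> l" "l < down_rate" and m: "down_rate < m" "m < r - \<delta> + drift"
  shows "eventually (\<lambda>t. K * (1 - m * (T - t)) \<le> critical_price M X r \<delta> K T t \<and>
    critical_price M X r \<delta> K T t \<le> K / (1 + l * (T - t))) (at_left T)"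
  using eventually_put_price_gt[OF K r l, of T \<delta>] eventually_put_price_le[OF K r m, of T]
proof eventually_elim
  case (elim t)
  let ?S = "{x. 0 \<le> x \<and> put_price M X r \<delta> K T t x > max 0 (K - x)}"
  have "critical_price M X r \<delta> K T t \<le> K / (1 + l * (T - t))"
    unfolding critical_price_def using elim by (intro cInf_lower) (auto intro!: bdd_belowI[of _ 0])
  moreover have "K * (1 - m * (T - t)) \<le> critical_price M X r \<delta> K T t"
    unfolding critical_price_def
  proof (rule cInf_greatest)
    show "?S \<noteq> {}" using elim by blast
    fix x assume "x \<in> ?S"
    \<comment> \<open>Up to this level the price is at most \<open>K - x\<close>, so no such
      \<open>x\<close> belongs to the set.\<close>
    then have "\<not> x \<le> K * (1 - m * (T - t))" using elim by force
    then show "K * (1 - m * (T - t)) \<le> x" by simp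
  qed
  ultimately show ?case by simp
qed

text \<open>The bounds on the critical price trap the quotient between \<open>l\<close> and
  \<open>m / (1 - m * (T - t))\<close>, the latter tending to \<open>m\<close>; then
  \<open>l\<close> and \<open>m\<close> are taken close to \<open>down_rate\<close>.\<close>

theorem critical_price_rate:
  assumes K: "0 < K" and r: "0 \<le> r" and rate: "0 < down_rate" "down_rate < r - \<delta> + drift"
  shows "((\<lambda>t. (K / critical_price M X r \<delta> K T t - 1) / (T - t)) \<longlongrightarrow> down_rate) (at_left T)"
proof -
  have bounds: "eventually (\<lambda>t. l \<le> (K / critical_price M X r \<delta> K T t - 1) / (T - t) \<and>
      (K / critical_price M X r \<delta> K T t - 1) / (T - t) \<le> m / (1 - m * (T - t))) (at_left T)"
    if l: "0 \<le> l" "l < down_rate" and m: "down_rate < m" "m < r - \<delta> + drift" for l m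
  proof -
    have "((\<lambda>s. 1 - m * s) \<longlongrightarrow> 1 - m * 0) (at_right 0)" by (intro tendsto_intros)
    then have "eventually (\<lambda>s. 0 < 1 - m * s) (at_right 0)" by (rule order_tendstoD) simp
    from eventually_critical_price_bounds[OF K r l m, of T] eventually_time_to_maturity[OF this, of T]
      eventually_time_to_maturity[OF eventually_at_right_less, of T]
    show ?thesis
    proof eventually_elim
      case (elim t)
      define s b where "s = T - t" and "b = critical_price M X r \<delta> K T t"
      have s: "0 < s" and ms: "0 < 1 - m * s" and b: "K * (1 - m * s) \<le> b" "b \<le> K / (1 + l * s)"
        using elim by (auto simp: s_def b_def)
      have ls: "0 < 1 + l * s" using l s by (simp add: add_pos_nonneg)
      have "0 < K * (1 - m * s)" using K ms by simp
      with b have b0: "0 < b" by linarith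
      have "1 + l * s \<le> K / b" using b(2) b0 ls by (simp add: field_simps)
      then have 1: "l \<le> (K / b - 1) / s" using s by (simp add: field_simps)
      have "K / b \<le> 1 / (1 - m * s)" using b(1) b0 ms by (simp add: field_simps)
      then have "K / b - 1 \<le> 1 / (1 - m * s) - 1" by simp
      also have "\<dots> = m / (1 - m * s) * s" using ms by (simp add: field_simps)
      finally have 2: "(K / b - 1) / s \<le> m / (1 - m * s)" using s by (simp add: divide_le_eq)
      from 1 2 show ?case by (simp add: s_def b_def)
    qed
  qed
  show ?thesis
  proof (rule order_tendstoI)
    fix a assume "a < down_rate"
    then have "max a 0 < down_rate" using rate by simp
    then obtain l where "max a 0 < l" "l < down_rate" using dense by blast
    moreover obtain m where "down_rate < m" "m < r - \<delta> + drift" using dense[OF rate(2)] by blast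
    ultimately show "eventually (\<lambda>t. a < (K / critical_price M X r \<delta> K T t - 1) / (T - t)) (at_left T)"
      using bounds[of l m] by (auto elim!: eventually_mono)
  next
    fix a assume "down_rate < a"
    then have "down_rate < min a (r - \<delta> + drift)" using rate by simp
    then obtain m where m: "down_rate < m" "m < min a (r - \<delta> + drift)" using dense by blast
    have "((\<lambda>s. m / (1 - m * s)) \<longlongrightarrow> m / (1 - m * 0)) (at_right 0)" by (intro tendsto_intros) auto
    then have "eventually (\<lambda>s. m / (1 - m * s) < a) (at_right 0)" by (rule order_tendstoD) (use m in simp)
    \<comment> \<open>Only the upper bound matters here, so \<open>l = 0\<close> suffices; it is
      admissible because \<open>down_rate\<close> is positive.\<close>
    from eventually_time_to_maturity[OF this, of T] bounds[of 0 m]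
    show "eventually (\<lambda>t. (K / critical_price M X r \<delta> K T t - 1) / (T - t) < a) (at_left T)"
      using m rate by (auto elim: eventually_elim2)
  qed
qed

end

theorem theorem5p2:
  fixes M :: "'a measure" and X :: "real \<Rightarrow> 'a \<Rightarrow> real"
    and \<sigma> \<gamma> T K r \<delta> :: real and \<nu> :: "real measure"
  assumes levy: "levy_process M X \<sigma> \<gamma> \<nu>"
    and T: "T > 0" and K: "K > 0" and r: "r > 0" and \<delta>: "\<delta> \<ge> 0"
    and exp_moment: "(\<integral>\<^sup>+ x. indicator {x. \<bar>x\<bar> \<ge> 1} x * ennreal (exp x) \<partial>\<nu>) < \<infinity>"
    and martingale: "\<sigma>\<^sup>2 / 2 + \<gamma> + (\<integral> x. exp x - 1 - x * indicator {-1..1} x \<partial>\<nu>) = 0"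
    and nondeg: "\<sigma> \<noteq> 0 \<or> emeasure \<nu> {..<0} > 0 \<or>
                 (\<integral>\<^sup>+ x. indicator {0<..} x * ennreal (min x 1) \<partial>\<nu>) = \<infinity>"
    and fv_sigma: "\<sigma> = 0"
    and fv_nu: "(\<integral>\<^sup>+ x. indicator {-1..1} x * ennreal \<bar>x\<bar> \<partial>\<nu>) < \<infinity>"
    and dplus: "r - \<delta> - (\<integral> y. max 0 (exp y - 1) \<partial>\<nu>) > 0"
  shows "((\<lambda>t. (K / critical_price M X r \<delta> K T t - 1) / (T - t))
            \<longlongrightarrow> (\<integral> y. max 0 (1 - exp y) \<partial>\<nu>)) (at_left T)"
proof -
  interpret finite_variation_levy M X \<gamma> \<nu>
    by unfold_locales (use levy exp_moment martingale fv_nu fv_sigma in auto)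
  have "down_rate < r - \<delta> + drift" using dplus drift_eq by simp
  with critical_price_rate[OF K _ down_rate_pos, of r \<delta> T] nondeg fv_sigma r show ?thesis
    by (simp add: down_rate_def)
qed

end
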